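(* Let $\mathcal{M}=(S,A,AP,L,I)$ be an interval Markov decision process and let $s,t\in S$ with $s\sim_{(\exists\pi\forall)} t$. Then for every PCTL state formula $\varphi$ we have $s\models_{(\exists\pi\forall)}\varphi$ if and only if $t\models_{(\exists\pi\forall)}\varphi$.
   Context: An interval MDP (IMDP) is a tuple $(S,A,AP,L,I)$ with $S$ a finite set of states, $A$ a finite set of actions, $AP$ a finite set of atomic propositions, $L:S\to 2^{AP}$ a labelling, and $I:S\times A\times S\to\mathbb{I}$ where $\mathbb{I}$ is a set of subintervals of $[0,1]$. For $s\in S,a\in A$, write $s\xrightarrow{a}\mu$ if $\mu$ is a probability distribution on $S$ with $\mu(s')\in I(s,a,s')$ for all $s'$; the set $\Gamma_{s,a}=\{\mu\mid s\xrightarrow{a}\mu\}$ is required to be non-empty. A scheduler is a function $\sigma$ from finite paths to distributions over $A$; a nature is a function $\pi$ mapping a finite path $\omega$ and action $a$ to an element of $\Gamma_{\mathrm{last}(\omega),a}$, where $\mathrm{last}(\omega)$ is the last state of $\omega$. $\Sigma,\Pi$ denote the sets of all schedulers and natures. $\Pr^{\sigma,\pi}_s$ is the unique probability measure on infinite paths (cylinder $\sigma$-algebra) with the one-state cylinder of $s'$ having probability $1$ iff $s'=s$ (else $0$), and $\Pr^{\sigma,\pi}_s[\mathrm{Cyl}(\omega s')]=\Pr^{\sigma,\pi}_s[\mathrm{Cyl}(\omega)]\cdot\sum_{a}\sigma(\omega)(a)\pi(\omega,a)(s')$. PCTL: state formulas $\varphi::=\mathit{true}\mid x\mid\neg\varphi\mid\varphi_1\wedge\varphi_2\mid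 \mathsf{P}_{\bowtie p}(\psi)$, path formulas $\psi::=\mathsf{X}\varphi\mid\varphi_1\mathsf{U}\varphi_2\mid\varphi_1\mathsf{U}^{\le k}\varphi_2$ ($x\in AP$, rational $p\in[0,1]$, $\bowtie\in\{\le,<,\ge,>\}$, $k\in\mathbb{N}$). The relation $\models_{(\exists\pi\forall)}$: $s\models x$ iff $x\in L(s)$; negation, conjunction as usual; $s\models_{(\exists\pi\forall)}\mathsf{P}_{\bowtie p}(\psi)$ iff there exists $\pi\in\Pi$ such that for all $\sigma\in\Sigma$, $\Pr^{\sigma,\pi}_s[\{\omega\mid\omega\models_{(\exists\pi\forall)}\psi\}]\bowtie p$. For $\omega=s_1s_2\cdots$: $\omega\models\mathsf{X}\varphi$ iff $s_2\models\varphi$; $\omega\models\varphi_1\mathsf{U}^{\le k}\varphi_2$ iff some $i\le k$ has $s_i\models\varphi_2$ and $s_j\models\varphi_1$ for all $j<i$; $\omega\models\varphi_1\mathsf{U}\varphi_2$ iff $\omega\models\varphi_1\mathsf{U}^{\le k}\varphi_2$ for some $k$. For a family $(\mu_a)_{a\in A}$ of distributions write $s\xrightarrow{(\mu_a)}\mu$ if there is $\rho\in\mathrm{Dist}(A)$ with $\mu=\sum_a\rho(a)\mu_a$. An equivalence relation $R\subseteq S\times S$ is a probabilistic $(\exists\pi\forall)$-bisimulation if for all $(s,t)\in R$: $L(s)=L(t)$, and for each $(\mu_a)_{a\in A}$ with $s\xrightarrow{a}\mu_a$ for all $a$ there is $(\nu_a)_{a\in A}$ with $t\xrightarrow{a}\nu_a$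 for all $a$ such that for each $t\xrightarrow{(\nu_a)}\nu$ there is $s\xrightarrow{(\mu_a)}\mu$ with $\mu(C)=\nu(C)$ for every equivalence class $C$ of $R$. $s\sim_{(\exists\pi\forall)}t$ iff some such bisimulation contains $(s,t)$. *)

theory Defs
  imports "HOL-Probability.Probability"
begin

definition Gamma :: "('s \<Rightarrow> 'a \<Rightarrow> 's \<Rightarrow> real set) \<Rightarrow> 's \<Rightarrow> 'a \<Rightarrow> 's pmf set" where
  "Gamma I s a = {\<mu>. \<forall>s'. pmf \<mu> s' \<in> I s a s'}"

definition is_IMDP :: "('s::finite \<Rightarrow> 'a::finite \<Rightarrow> 's \<Rightarrow> real set) \<Rightarrow> bool" where
  "is_IMDP I \<longleftrightarrow>
     (\<forall>s a s'. is_interval (I s a s') \<and> I s a s' \<subseteq> {0..1}) \<and>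
     (\<forall>s a. Gamma I s a \<noteq> {})"

text \<open>Finite paths are nonempty lists of states; schedulers are arbitrary functions
  from finite paths to distributions over actions (values on the empty list are irrelevant).\<close>

definition is_nature :: "('s \<Rightarrow> 'a \<Rightarrow> 's \<Rightarrow> real set) \<Rightarrow> ('s list \<Rightarrow> 'a \<Rightarrow> 's pmf) \<Rightarrow> bool" where
  "is_nature I \<pi> \<longleftrightarrow> (\<forall>w a. w \<noteq> [] \<longrightarrow> \<pi> w a \<in> Gamma I (last w) a)"

definition cyl :: "'s list \<Rightarrow> 's stream set" where
  "cyl w = {x. stake (length w) x = w}"

definition is_path_measure ::
  "('s::finite list \<Rightarrow> 'a::finite pmf) \<Rightarrow> ('s list \<Rightarrow> 'a \<Rightarrow> 's pmf) \<Rightarrow> 's \<Rightarrow> 's stream measure \<Rightarrow> bool" where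
  "is_path_measure \<sigma> \<pi> s P \<longleftrightarrow>
     sets P = sets (stream_space (count_space UNIV)) \<and> prob_space P \<and>
     (\<forall>s'. measure P (cyl [s']) = (if s' = s then 1 else 0)) \<and>
     (\<forall>w s'. w \<noteq> [] \<longrightarrow>
        measure P (cyl (w @ [s'])) = measure P (cyl w) * (\<Sum>a\<in>UNIV. pmf (\<sigma> w) a * pmf (\<pi> w a) s'))"

definition Pr :: "('s::finite list \<Rightarrow> 'a::finite pmf) \<Rightarrow> ('s list \<Rightarrow> 'a \<Rightarrow> 's pmf) \<Rightarrow> 's \<Rightarrow> 's stream measure" where
  "Pr \<sigma> \<pi> s = (THE P. is_path_measure \<sigma> \<pi> s P)"

datatype cmp = CLe | CLt | CGe | CGt

fun cmp_holds :: "cmp \<Rightarrow> real \<Rightarrow> real \<Rightarrow> bool" where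
  "cmp_holds CLe x p = (x \<le> p)"
| "cmp_holds CLt x p = (x < p)"
| "cmp_holds CGe x p = (x \<ge> p)"
| "cmp_holds CGt x p = (x > p)"

datatype 'ap sform = STrue | SAtom 'ap | SNeg "'ap sform" | SAnd "'ap sform" "'ap sform"
  | SProb cmp rat "'ap pform"
and 'ap pform = PNext "'ap sform" | PUntil "'ap sform" "'ap sform"
  | PBUntil "'ap sform" "'ap sform" nat

primrec wf_sform :: "'ap sform \<Rightarrow> bool" and wf_pform :: "'ap pform \<Rightarrow> bool" where
  "wf_sform STrue = True"
| "wf_sform (SAtom x) = True"
| "wf_sform (SNeg f) = wf_sform f"
| "wf_sform (SAnd f g) = (wf_sform f \<and> wf_sform g)"
| "wf_sform (SProb c p \<psi>) = (0 \<le> p \<and> p \<le> 1 \<and> wf_pform \<psi>)"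
| "wf_pform (PNext f) = wf_sform f"
| "wf_pform (PUntil f g) = (wf_sform f \<and> wf_sform g)"
| "wf_pform (PBUntil f g k) = (wf_sform f \<and> wf_sform g)"

text \<open>Semantics \<open>\<models>_{(\<exists>\<pi>\<forall>)}\<close>.  A path \<open>\<omega> = s_1 s_2 \<dots>\<close> is a stream with
  \<open>s_i = \<omega> !! (i - 1)\<close>.\<close>
primrec sat_state :: "('s::finite \<Rightarrow> 'ap set) \<Rightarrow> ('s \<Rightarrow> 'a::finite \<Rightarrow> 's \<Rightarrow> real set) \<Rightarrow> 's \<Rightarrow> 'ap sform \<Rightarrow> bool"
and sat_path :: "('s::finite \<Rightarrow> 'ap set) \<Rightarrow> ('s \<Rightarrow> 'a::finite \<Rightarrow> 's \<Rightarrow> real set) \<Rightarrow> 's stream \<Rightarrow> 'ap pform \<Rightarrow> bool"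
where
  "sat_state L I s STrue = True"
| "sat_state L I s (SAtom x) = (x \<in> L s)"
| "sat_state L I s (SNeg f) = (\<not> sat_state L I s f)"
| "sat_state L I s (SAnd f g) = (sat_state L I s f \<and> sat_state L I s g)"
| "sat_state L I s (SProb c p \<psi>) =
     (\<exists>\<pi>. is_nature I \<pi> \<and>
        (\<forall>\<sigma>::'s list \<Rightarrow> 'a pmf.
           cmp_holds c (measure (Pr \<sigma> \<pi> s) {\<omega>. sat_path L I \<omega> \<psi>}) (real_of_rat p)))"
| "sat_path L I \<omega> (PNext f) = sat_state L I (\<omega> !! 1) f"
| "sat_path L I \<omega> (PBUntil f g k) =
     (\<exists>i. 1 \<le> i \<and> i \<le> k \<and> sat_state L I (\<omega> !! (i - 1)) g \<and>
          (\<forall>j. 1 \<le> j \<and> j < i \<longrightarrow> sat_state L I (\<omega> !! (j - 1)) f))"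
| "sat_path L I \<omega> (PUntil f g) =
     (\<exists>k. \<exists>i. 1 \<le> i \<and> i \<le> k \<and> sat_state L I (\<omega> !! (i - 1)) g \<and>
          (\<forall>j. 1 \<le> j \<and> j < i \<longrightarrow> sat_state L I (\<omega> !! (j - 1)) f))"

definition mixture :: "('a::finite \<Rightarrow> 's pmf) \<Rightarrow> 's pmf \<Rightarrow> bool" where
  "mixture \<nu>s \<nu> \<longleftrightarrow> (\<exists>\<rho>::'a pmf. \<forall>s'. pmf \<nu> s' = (\<Sum>a\<in>UNIV. pmf \<rho> a * pmf (\<nu>s a) s'))"

definition is_bisim :: "('s::finite \<Rightarrow> 'ap set) \<Rightarrow> ('s \<Rightarrow> 'a::finite \<Rightarrow> 's \<Rightarrow> real set) \<Rightarrow> ('s \<times> 's) set \<Rightarrow> bool" where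
  "is_bisim L I R \<longleftrightarrow> equiv UNIV R \<and>
     (\<forall>(s, t) \<in> R. L s = L t \<and>
        (\<forall>\<mu>s :: 'a \<Rightarrow> 's pmf. (\<forall>a. \<mu>s a \<in> Gamma I s a) \<longrightarrow>
           (\<exists>\<nu>s :: 'a \<Rightarrow> 's pmf. (\<forall>a. \<nu>s a \<in> Gamma I t a) \<and>
              (\<forall>\<nu>. mixture \<nu>s \<nu> \<longrightarrow>
                 (\<exists>\<mu>. mixture \<mu>s \<mu> \<and>
                    (\<forall>C \<in> UNIV // R. measure_pmf.prob \<mu> C = measure_pmf.prob \<nu> C))))))"

definition bisimilar :: "('s::finite \<Rightarrow> 'ap set) \<Rightarrow> ('s \<Rightarrow> 'a::finite \<Rightarrow> 's \<Rightarrow> real set) \<Rightarrow> 's \<Rightarrow> 's \<Rightarrow> bool" where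
  "bisimilar L I s t \<longleftrightarrow> (\<exists>R. is_bisim L I R \<and> (s, t) \<in> R)"

end

theory Submission
  imports Defs
begin

text \<open>
  Bounded path formulas are settled by backward induction: to transfer a nature from \<open>s\<close> to \<open>t\<close>,
  in every class of successors imitate the representative that is best for nature.

  For unbounded until this fails in the limit, and the intervals need not be closed, so optimal
  natures need not exist.  Instead, the values of the two games, in which nature minimises or maximises
  the probability of the until formula, are least fixpoints of a one-step operator and hence
  constant on classes.  Against a minimising nature the scheduler has a best response that attains
  at least the value, and against a maximising one a response that stays below it; this settles
  strict bounds.  For non-strict bounds it remains to see that the existence of an exactly optimal nature
  is invariant.  An action is tight if it preserves the expected value.  On the classes of states with
  an optimal nature one can play memorylessly, since tight actions stay in these classes and all other
  actions leave a gap that pays for near-optimal play elsewhere.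
\<close>

section \<open>Path measures\<close>

text \<open>The scheduler answers a nature that is already fixed, so one round of the game is an
  extremum over nature's joint choice for all actions of the opposite extremum over actions. Beyond
  labels, bisimilarity enters through one fact: the distribution chosen for an action at
  \<open>t\<close> averages invariant functions like some mixture of the distributions chosen at
  \<open>s\<close>, hence never beats the best of them for the scheduler.

  Limits treat the two kinds of bound differently. An upper bound valid at every finite horizon
  passes to the unbounded probability, so a player who wants it small only has to avoid raising the
  expected value. A player who wants it large must also make progress, since an action can preserve
  the expected value forever without approaching the target. For the scheduler this is solved by
  actions that preserve the value whatever nature does, which leaves the choice among them free to
  serve progress; for an exactly optimal maximising nature, by a rank on states.\<close>

lemma pmf_bind_finite:
  fixes p :: "'a::finite pmf"
  shows "pmf (bind_pmf p f) y = (\<Sum>a\<in>UNIV. pmf p a * pmf (f a) y)"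
  by (simp add: pmf_bind integral_measure_pmf_real[of UNIV] mult.commute)

lemma cyl_snoc: "cyl (w @ [x]) = cyl w \<inter> {\<omega>. \<omega> !! length w = x}"
  by (auto simp: cyl_def stake_Suc simp del: stake.simps)

lemma cyl_measurable [measurable]: "cyl w \<in> sets (stream_space (count_space (UNIV :: 's::finite set)))"
proof -
  have "cyl w = {\<omega> \<in> space (stream_space (count_space UNIV)). stake (length w) \<omega> = w}"
    by (simp add: cyl_def space_stream_space)
  also have "\<dots> \<in> sets (stream_space (count_space UNIV))"
    by measurable
  finally show ?thesis .
qed

text \<open>Connects cylinders with the generator of the stream sigma-algebra for which uniqueness
  of measures is available.\<close>

lemma cyl_eq_sstart: "cyl w = sstart UNIV w"
proof (induction w)
  case (Cons x w)
  have "\<omega> \<in> cyl (x # w) \<longleftrightarrow> shd \<omega> = x \<and> stl \<omega> \<in> cyl w" for \<omega>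
    by (auto simp: cyl_def)
  with Cons show ?case by auto
qed (simp add: cyl_def)

section \<open>Paths driven by a table of successors\<close>

primrec visited :: "'s \<Rightarrow> ('s list \<Rightarrow> 's) \<Rightarrow> nat \<Rightarrow> 's list" where
  "visited s x 0 = [s]"
| "visited s x (Suc n) = visited s x n @ [x (visited s x n)]"

definition walk :: "'s \<Rightarrow> ('s list \<Rightarrow> 's) \<Rightarrow> 's stream" where
  "walk s x = to_stream (\<lambda>n. last (visited s x n))"

lemma walk_nth: "walk s x !! n = last (visited s x n)"
  by (simp add: walk_def to_stream_def)

lemma stake_walk: "stake (Suc n) (walk s x) = visited s x n"
proof (induction n)
  case (Suc n)
  then show ?case
    by (subst stake_Suc) (simp add: walk_nth del: stake.simps snth.simps)
qed (simp add: walk_nth flip: snth.simps(1))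

lemma walk_in_cyl_single: "walk s x \<in> cyl [y] \<longleftrightarrow> y = s"
  by (auto simp: cyl_def walk_nth simp flip: snth.simps(1))

lemma walk_in_cyl_snoc:
  assumes "w \<noteq> []"
  shows "walk s x \<in> cyl (w @ [y]) \<longleftrightarrow> walk s x \<in> cyl w \<and> x w = y"
proof -
  obtain n where n: "length w = Suc n"
    using assms by (cases w) auto
  have "walk s x !! length w = x w" if "walk s x \<in> cyl w"
  proof -
    have "visited s x n = w"
      using that stake_walk[of n s x] n by (simp add: cyl_def)
    then show ?thesis
      by (simp add: n walk_nth del: snth.simps)
  qed
  then show ?thesis
    by (auto simp: cyl_snoc)
qed

text \<open>The coordinates of \<open>x\<close> that decide whether the walk follows
  \<open>w\<close>. The range starts at 1 because histories are nonempty, and stops before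
  \<open>length w\<close> because the successor of the full \<open>w\<close> is left open.\<close>

definition proper_prefixes :: "'s list \<Rightarrow> 's list set" where
  "proper_prefixes w = (\<lambda>k. take k w) ` {1..<length w}"

lemma proper_prefixes_snoc:
  "w \<noteq> [] \<Longrightarrow> proper_prefixes (w @ [y]) = insert w (proper_prefixes w)"
  by (auto simp: proper_prefixes_def atLeastLessThanSuc Suc_le_eq)

lemma proper_prefixes_length: "v \<in> proper_prefixes w \<Longrightarrow> length v < length w"
  by (auto simp: proper_prefixes_def)

text \<open>In terms of \<open>x\<close> a cylinder is a rectangle: each nonempty strict prefix
  fixes one coordinate, namely the letter of \<open>w\<close> that follows it.\<close>

lemma walk_in_cyl:
  assumes "w \<noteq> []"
  shows "walk s x \<in> cyl w \<longleftrightarrow> hd w = s \<and> (\<forall>v\<in>proper_prefixes w. x v = w ! length v)"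
  using assms
proof (induction w rule: rev_nonempty_induct)
  case (single y)
  then show ?case
    by (auto simp: walk_in_cyl_single proper_prefixes_def)
next
  case (snoc y w)
  have "(\<forall>v\<in>proper_prefixes w. x v = (w @ [y]) ! length v)
      \<longleftrightarrow> (\<forall>v\<in>proper_prefixes w. x v = w ! length v)"
    by (intro ball_cong refl) (simp add: nth_append proper_prefixes_length)
  with snoc show ?case
    by (auto simp: walk_in_cyl_snoc proper_prefixes_snoc)
qed

lemma visited_measurable:
  fixes M :: "'s::finite list \<Rightarrow> 's measure"
  assumes "\<And>w. sets (M w) = UNIV"
  shows "(\<lambda>x. visited s x n) \<in> measurable (PiM UNIV M) (count_space UNIV)"
proof (induction n)
  case (Suc n)
  note Suc [measurable]
  have comp: "(\<lambda>x. x w) \<in> measurable (PiM UNIV M) (count_space UNIV)" for w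
  proof -
    have "(\<lambda>x. x w) \<in> measurable (PiM UNIV M) (M w)"
      by (rule measurable_component_singleton) simp
    moreover have "sets (count_space UNIV :: 's measure) = sets (M w)"
      using assms by simp
    ultimately show ?thesis
      using measurable_cong_sets[OF refl, of "count_space UNIV" "M w" "PiM UNIV M"] by blast
  qed
  have "(\<lambda>x. x (visited s x n)) \<in> measurable (PiM UNIV M) (count_space UNIV)"
    by (rule measurable_compose_countable[OF comp Suc])
  then show ?case
    by simp measurable
qed simp

lemma walk_measurable:
  fixes M :: "'s::finite list \<Rightarrow> 's measure"
  assumes "\<And>w. sets (M w) = UNIV"
  shows "walk s \<in> measurable (PiM UNIV M) (stream_space (count_space UNIV))"
proof (rule measurable_stream_space2)
  fix n
  show "(\<lambda>x. walk s x !! n) \<in> measurable (PiM UNIV M) (count_space UNIV)"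
    using measurable_compose[OF visited_measurable[OF assms, of s n], of last]
    by (simp add: walk_nth)
qed

text \<open>All random choices are drawn in advance: an independent product over the histories
  selects the successor taken after each of them.\<close>

lemma path_measure_exists:
  fixes \<sigma> :: "'s::finite list \<Rightarrow> 'a::finite pmf"
  shows "\<exists>P. is_path_measure \<sigma> \<pi> s P"
proof -
  define M where "M w = measure_pmf (bind_pmf (\<sigma> w) (\<pi> w))" for w
  have sets_M: "sets (M w) = UNIV" and prob_M: "prob_space (M w)" for w
    by (simp_all add: M_def prob_space_measure_pmf)
  interpret product_prob_space M UNIV
    using prob_M by (simp add: product_prob_spaceI)
  let ?S = "stream_space (count_space (UNIV :: 's set))"
  define P where "P = distr (PiM UNIV M) ?S (walk s)"
  note [measurable] = walk_measurable[of M s, OF sets_M]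
  have space: "space (PiM UNIV M) = UNIV"
    by (simp add: space_PiM M_def)
  have eq: "emeasure P (cyl w) = emeasure (PiM UNIV M) {x. walk s x \<in> cyl w}" for w
    unfolding P_def by (subst emeasure_distr) (auto simp: space vimage_def)
  have prod: "emeasure P (cyl w) = (if hd w = s then \<Prod>v\<in>proper_prefixes w. emeasure (M v) {w ! length v} else 0)"
    if "w \<noteq> []" for w
  proof (cases "hd w = s")
    case True
    have "emeasure P (cyl w) = emeasure (PiM UNIV M)
        {x \<in> space (PiM UNIV M). \<forall>v\<in>proper_prefixes w. x v \<in> {w ! length v}}"
      by (simp add: eq walk_in_cyl that True space)
    also have "\<dots> = (\<Prod>v\<in>proper_prefixes w. emeasure (M v) {w ! length v})"
      by (rule emeasure_PiM_Collect) (auto simp: sets_M proper_prefixes_def)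
    finally show ?thesis
      using True by simp
  next
    case False
    then show ?thesis
      by (simp add: eq walk_in_cyl that)
  qed
  \<comment> \<open>The history \<open>w\<close> is longer than all its proper prefixes, so it is a
    fresh coordinate and contributes an independent factor.\<close>
  have step: "emeasure P (cyl (w @ [y])) = emeasure P (cyl w) * emeasure (M w) {y}" if "w \<noteq> []" for w y
  proof -
    have "w \<notin> proper_prefixes w"
      using proper_prefixes_length by blast
    moreover have "(\<Prod>v\<in>proper_prefixes w. emeasure (M v) {(w @ [y]) ! length v})
        = (\<Prod>v\<in>proper_prefixes w. emeasure (M v) {w ! length v})"
      by (intro prod.cong refl) (simp add: nth_append proper_prefixes_length)
    moreover have "finite (proper_prefixes w)"
      by (simp add: proper_prefixes_def)
    ultimately show ?thesis
      using that by (simp add: prod proper_prefixes_snoc mult.commute)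
  qed
  have "is_path_measure \<sigma> \<pi> s P"
    unfolding is_path_measure_def
  proof (intro conjI allI impI)
    show "sets P = sets ?S"
      by (simp add: P_def)
    show "prob_space P"
      unfolding P_def by (rule prob_space_distr) simp
    show "measure P (cyl [y]) = (if y = s then 1 else 0)" for y
      by (simp add: measure_def prod proper_prefixes_def)
    show "measure P (cyl (w @ [y])) = measure P (cyl w) * (\<Sum>a\<in>UNIV. pmf (\<sigma> w) a * pmf (\<pi> w a) y)"
      if "w \<noteq> []" for w y
      using step[OF that, of y] 
      by (simp add: measure_def enn2real_mult M_def emeasure_pmf_single pmf_bind_finite sum_nonneg)
  qed
  then show ?thesis by blast
qed

text \<open>Cylinders determine a probability measure on streams, and the defining recursion fixes
  their probabilities letter by letter.\<close>

lemma path_measure_unique: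
  assumes "is_path_measure \<sigma> \<pi> s P" "is_path_measure \<sigma> \<pi> s Q"
  shows "P = Q"
proof (rule stream_space_eq_sstart[of UNIV])
  interpret P: prob_space P using assms by (simp add: is_path_measure_def)
  interpret Q: prob_space Q using assms by (simp add: is_path_measure_def)
  show "prob_space P" "prob_space Q" by unfold_locales
  show "sets P = sets (stream_space (count_space UNIV))" "sets Q = sets (stream_space (count_space UNIV))"
    using assms by (simp_all add: is_path_measure_def)
  fix w :: "'a list" assume "w \<noteq> []"
  then have "measure P (cyl w) = measure Q (cyl w)"
  proof (induction w rule: rev_nonempty_induct)
    case (single x)
    then show ?case using assms by (simp add: is_path_measure_def)
  next
    case (snoc x w)
    then show ?case using assms by (simp add: is_path_measure_def)
  qed
  then show "emeasure P (sstart UNIV w) = emeasure Q (sstart UNIV w)"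
    by (simp add: P.emeasure_eq_measure Q.emeasure_eq_measure flip: cyl_eq_sstart)
qed auto

lemma is_path_measure_Pr: "is_path_measure \<sigma> \<pi> s (Pr \<sigma> \<pi> s)"
  unfolding Pr_def
  using path_measure_exists[of \<sigma> \<pi> s] path_measure_unique by (metis theI)

section \<open>Averages, strategies and bounded horizons\<close>

definition av :: "'x::finite pmf \<Rightarrow> ('x \<Rightarrow> real) \<Rightarrow> real" where
  "av \<mu> U = (\<Sum>x\<in>UNIV. pmf \<mu> x * U x)"

lemma av_const [simp]: "av \<mu> (\<lambda>_. c) = c"
  by (simp add: av_def sum_pmf_eq_1 flip: sum_distrib_right)

lemma av_add: "av \<mu> (\<lambda>x. U x + W x) = av \<mu> U + av \<mu> W"
  by (simp add: av_def distrib_left sum.distrib)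

lemma av_diff: "av \<mu> (\<lambda>x. U x - W x) = av \<mu> U - av \<mu> W"
  by (simp add: av_def right_diff_distrib sum_subtractf)

lemma av_minus: "av \<mu> (\<lambda>x. - U x) = - av \<mu> U"
  by (simp add: av_def sum_negf)

lemma av_cmult: "av \<mu> (\<lambda>x. c * U x) = c * av \<mu> U"
  by (simp add: av_def sum_distrib_left mult_ac)

lemma av_mono:
  assumes "\<And>x. x \<in> set_pmf \<mu> \<Longrightarrow> U x \<le> W x"
  shows "av \<mu> U \<le> av \<mu> W"
  unfolding av_def
proof (rule sum_mono)
  fix x
  show "pmf \<mu> x * U x \<le> pmf \<mu> x * W x"
    using assms[of x] by (cases "x \<in> set_pmf \<mu>") (auto simp: set_pmf_iff mult_left_mono)
qed

lemma av_cong: "(\<And>x. x \<in> set_pmf \<mu> \<Longrightarrow> U x = W x) \<Longrightarrow> av \<mu> U = av \<mu> W"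
  by (intro antisym av_mono) auto

lemma av_le: "(\<And>x. x \<in> set_pmf \<mu> \<Longrightarrow> U x \<le> c) \<Longrightarrow> av \<mu> U \<le> c"
  using av_mono[of \<mu> U "\<lambda>_. c"] by simp

lemma av_ge: "(\<And>x. x \<in> set_pmf \<mu> \<Longrightarrow> c \<le> U x) \<Longrightarrow> c \<le> av \<mu> U"
  using av_mono[of \<mu> "\<lambda>_. c" U] by simp

lemma av_strict_mono:
  assumes "\<And>x. x \<in> set_pmf \<mu> \<Longrightarrow> U x \<le> W x" "y \<in> set_pmf \<mu>" "U y < W y"
  shows "av \<mu> U < av \<mu> W"
  unfolding av_def
proof (rule sum_strict_mono_ex1)
  show "\<forall>x\<in>UNIV. pmf \<mu> x * U x \<le> pmf \<mu> x * W x"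
  proof
    fix x
    show "pmf \<mu> x * U x \<le> pmf \<mu> x * W x"
      using assms(1)[of x] by (cases "x \<in> set_pmf \<mu>") (auto simp: set_pmf_iff mult_left_mono)
  qed
  show "\<exists>x\<in>UNIV. pmf \<mu> x * U x < pmf \<mu> x * W x"
    using assms(2,3) by (intro bexI[of _ y]) (auto simp: pmf_positive)
qed simp

lemma av_return [simp]: "av (return_pmf x) U = U x"
proof -
  have "av (return_pmf x) U = av (return_pmf x) (\<lambda>_. U x)"
    by (rule av_cong) simp
  then show ?thesis by simp
qed

lemma av_pos_iff:
  assumes "\<And>x. 0 \<le> U x"
  shows "0 < av \<mu> U \<longleftrightarrow> (\<exists>x\<in>set_pmf \<mu>. 0 < U x)"
proof
  assume "0 < av \<mu> U"
  show "\<exists>x\<in>set_pmf \<mu>. 0 < U x"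
  proof (rule ccontr)
    assume "\<not> ?thesis"
    then have "av \<mu> U \<le> 0" by (intro av_le) force
    with \<open>0 < av \<mu> U\<close> show False by simp
  qed
next
  assume "\<exists>x\<in>set_pmf \<mu>. 0 < U x"
  then obtain x where "x \<in> set_pmf \<mu>" "0 < U x" by blast
  then have "av \<mu> (\<lambda>_. 0) < av \<mu> U"
    using assms by (intro av_strict_mono) auto
  then show "0 < av \<mu> U" by simp
qed

lemma av_tendsto:
  assumes "\<And>x. (\<lambda>n. U n x) \<longlonglongrightarrow> W x"
  shows "(\<lambda>n. av \<mu> (U n)) \<longlonglongrightarrow> av \<mu> W"
  unfolding av_def by (intro tendsto_sum tendsto_mult tendsto_const assms)

lemma av_mixture:
  assumes "\<And>s'. pmf \<nu> s' = (\<Sum>a\<in>UNIV. pmf \<rho> a * pmf (c a) s')"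
  shows "av \<nu> U = av \<rho> (\<lambda>a. av (c a) U)"
  unfolding av_def assms sum_distrib_right sum_distrib_left
  by (subst sum.swap) (simp add: mult_ac)

text \<open>An invariant function is constant on each class, so grouping the sum by classes leaves
  only class probabilities. In this form the class condition of a bisimulation is used
  throughout.\<close>

lemma av_eq_if_class_prob_eq:
  fixes \<mu> \<nu> :: "'s::finite pmf"
  assumes R: "equiv UNIV R"
    and prob: "\<And>C. C \<in> UNIV // R \<Longrightarrow> measure_pmf.prob \<mu> C = measure_pmf.prob \<nu> C"
    and inv: "\<And>x y. (x, y) \<in> R \<Longrightarrow> U x = U y"
  shows "av \<mu> U = av \<nu> U"
proof -
  have split: "av p U = (\<Sum>C\<in>UNIV // R. U (SOME x. x \<in> C) * measure_pmf.prob p C)" for p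
  proof -
    have part: "\<Union> (UNIV // R) = UNIV"
      using R by (rule Union_quotient)
    have "av p U = sum (\<lambda>x. pmf p x * U x) (\<Union> (UNIV // R))"
      by (simp add: av_def part)
    also have "\<dots> = (\<Sum>C\<in>UNIV // R. \<Sum>x\<in>C. pmf p x * U x)"
      using quotient_disj[OF R] by (subst sum.Union_disjoint) auto
    also have "\<dots> = (\<Sum>C\<in>UNIV // R. U (SOME x. x \<in> C) * measure_pmf.prob p C)"
    proof (rule sum.cong[OF refl])
      fix C assume C: "C \<in> UNIV // R"
      have "U x = U (SOME x. x \<in> C)" if "x \<in> C" for x
        using R C that by (intro inv) (metis quotient_eq_iff some_eq_ex[of "\<lambda>x. x \<in> C"])
      then have "(\<Sum>x\<in>C. pmf p x * U x) = (\<Sum>x\<in>C. pmf p x * U (SOME x. x \<in> C))"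
        by (intro sum.cong) auto
      then show "(\<Sum>x\<in>C. pmf p x * U x) = U (SOME x. x \<in> C) * measure_pmf.prob p C"
        by (simp only: measure_measure_pmf_finite[OF finite] sum_distrib_left) (simp add: mult.commute)
    qed
    finally show ?thesis .
  qed
  show ?thesis
    unfolding split by (intro sum.cong refl) (simp add: prob)
qed

section \<open>Shifting and gluing strategies\<close>

definition after :: "'s \<Rightarrow> ('s list \<Rightarrow> 'b) \<Rightarrow> 's list \<Rightarrow> 'b" where
  "after s f w = f (s # w)"

text \<open>A first move followed by a continuation that is selected by the second state. The
  continuation sees the history without the first state, so each \<open>k y\<close> is an ordinary
  strategy for plays from \<open>y\<close>. The value at \<open>[]\<close> is a dummy.\<close>

definition glue :: "('s \<Rightarrow> 'b) \<Rightarrow> ('s \<Rightarrow> 's list \<Rightarrow> 'b) \<Rightarrow> 's list \<Rightarrow> 'b" where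
  "glue f k w = (case w of [] \<Rightarrow> f undefined | x # v \<Rightarrow> (case v of [] \<Rightarrow> f x | y # _ \<Rightarrow> k y v))"

lemma glue_single [simp]: "glue f k [x] = f x"
  by (simp add: glue_def)

lemma after_glue [simp]: "after x (glue f k) (y # v) = k y (y # v)"
  by (simp add: glue_def after_def)

text \<open>The expected payoff of a play that is stopped on entering \<open>K\<close>, paying \<open>e\<close>, and after
  \<open>n\<close> steps at the latest, paying \<open>g\<close>.\<close>

primrec val :: "'s::finite set \<Rightarrow> ('s \<Rightarrow> real) \<Rightarrow> ('s \<Rightarrow> real) \<Rightarrow> nat
    \<Rightarrow> ('s list \<Rightarrow> 'a::finite pmf) \<Rightarrow> ('s list \<Rightarrow> 'a \<Rightarrow> 's pmf) \<Rightarrow> 's \<Rightarrow> real" where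
  "val K e g 0 \<sigma> \<pi> s = g s"
| "val K e g (Suc n) \<sigma> \<pi> s = (if s \<in> K then e s
     else av (\<sigma> [s]) (\<lambda>a. av (\<pi> [s] a) (val K e g n (after s \<sigma>) (after s \<pi>))))"

text \<open>Glued strategies agree with the continuation \<open>k x\<close> only on histories that
  start in \<open>x\<close>; this suffices for values at \<open>x\<close>.\<close>

lemma val_cong:
  assumes "\<And>v. \<sigma> (s # v) = \<sigma>' (s # v)" "\<And>v. \<pi> (s # v) = \<pi>' (s # v)"
  shows "val K e g n \<sigma> \<pi> s = val K e g n \<sigma>' \<pi>' s"
  using assms
proof (induction n arbitrary: \<sigma> \<sigma>' \<pi> \<pi>' s)
  case (Suc n)
  have "val K e g n (after s \<sigma>) (after s \<pi>) = val K e g n (after s \<sigma>') (after s \<pi>')"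
    by (intro ext Suc.IH) (simp_all add: after_def Suc.prems)
  with Suc.prems show ?case by simp
qed simp

lemma val_after_glue_sched [simp]:
  "val K e g n (after s (glue \<rho> k)) \<pi> = (\<lambda>x. val K e g n (k x) \<pi> x)"
  by (rule ext, rule val_cong) simp_all

text \<open>Negating the payoffs turns lower bounds into upper bounds, so one transfer argument
  serves all four comparisons.\<close>

lemma val_uminus: "val K (\<lambda>s. - e s) (\<lambda>s. - g s) n \<sigma> \<pi> s = - val K e g n \<sigma> \<pi> s"
proof (induction n arbitrary: \<sigma> \<pi> s)
  case (Suc n)
  have "val K (\<lambda>s. - e s) (\<lambda>s. - g s) n (after s \<sigma>) (after s \<pi>)
      = (\<lambda>x. - val K e g n (after s \<sigma>) (after s \<pi>) x)"
    using Suc.IH by (rule ext)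
  then show ?case by (simp add: av_minus)
qed simp

text \<open>A one-step move of nature: one distribution for each action. Being a product over
  actions, the set allows a move to be redefined for some actions and kept for the others.\<close>

definition choices :: "('s \<Rightarrow> 'a \<Rightarrow> 's \<Rightarrow> real set) \<Rightarrow> 's \<Rightarrow> ('a \<Rightarrow> 's pmf) set" where
  "choices I s = {c. \<forall>a. c a \<in> Gamma I s a}"

lemma choices_nonempty: "is_IMDP I \<Longrightarrow> choices I s \<noteq> {}"
proof -
  assume "is_IMDP I"
  then have "\<forall>a. \<exists>\<mu>. \<mu> \<in> Gamma I s a"
    unfolding is_IMDP_def by blast
  then have "\<exists>c. \<forall>a. c a \<in> Gamma I s a" by (rule choice)
  then show ?thesis by (auto simp: choices_def)
qed

lemma choices_selection:
  assumes "is_IMDP I"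
  obtains c where "\<And>s. c s \<in> choices I s"
proof -
  have "\<forall>s. \<exists>c. c \<in> choices I s"
    using choices_nonempty[OF assms] by blast
  then have "\<exists>c. \<forall>s. c s \<in> choices I s" by (rule choice)
  then show ?thesis using that by blast
qed

lemma nature_choices: "is_nature I \<pi> \<Longrightarrow> \<pi> [s] \<in> choices I s"
  unfolding is_nature_def choices_def by (auto dest: spec[of _ "[s]"])

lemma is_nature_after: "is_nature I \<pi> \<Longrightarrow> is_nature I (after s \<pi>)"
  unfolding is_nature_def after_def
proof (intro allI impI)
  fix w :: "'a list" and a :: 'b
  assume "\<forall>w a. w \<noteq> [] \<longrightarrow> \<pi> w a \<in> Gamma I (last w) a" "w \<noteq> []"
  from this(1)[rule_format, of "s # w" a] this(2) show "\<pi> (s # w) a \<in> Gamma I (last w) a"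
    by simp
qed

lemma is_nature_glue:
  assumes "\<And>x. c x \<in> choices I x" "\<And>x. is_nature I (j x)"
  shows "is_nature I (glue c j)"
  unfolding is_nature_def
proof (intro allI impI)
  fix w :: "'a list" and a :: 'b
  assume "w \<noteq> []"
  then consider x where "w = [x]" | x y v where "w = x # y # v"
    by (metis neq_Nil_conv)
  then show "glue c j w a \<in> Gamma I (last w) a"
  proof cases
    case 1
    then show ?thesis using assms(1) by (simp add: choices_def)
  next
    case 2
    have "j y (y # v) a \<in> Gamma I (last (y # v)) a"
      using assms(2) unfolding is_nature_def by blast
    with 2 show ?thesis by (simp add: glue_def)
  qed
qed

text \<open>The bisimulation condition is applied to the point mixture at \<open>a\<close>. Thus
  \<open>d a\<close> has the class probabilities of a mixture of the \<open>c b\<close>, and the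
  average of an invariant function under \<open>d a\<close> is a convex combination of its averages
  under the \<open>c b\<close>. The weights \<open>\<rho>\<close> depend on \<open>a\<close> but not
  on the function.\<close>

lemma bisim_choice_match:
  fixes I :: "'s::finite \<Rightarrow> 'a::finite \<Rightarrow> 's \<Rightarrow> real set"
  assumes "is_bisim L I R" "(s, t) \<in> R" "c \<in> choices I s"
  obtains d where "d \<in> choices I t"
    "\<And>a. \<exists>\<rho> :: 'a pmf. \<forall>U. (\<forall>x y. (x, y) \<in> R \<longrightarrow> U x = U y) \<longrightarrow> av (d a) U = av \<rho> (\<lambda>b. av (c b) U)"
proof -
  have R: "equiv UNIV R" using assms(1) by (simp add: is_bisim_def)
  obtain d where d: "\<forall>a. d a \<in> Gamma I t a"
    and match: "\<And>\<nu>. mixture d \<nu> \<Longrightarrow> \<exists>\<mu>. mixture c \<mu> \<and>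
      (\<forall>C \<in> UNIV // R. measure_pmf.prob \<mu> C = measure_pmf.prob \<nu> C)"
    using assms unfolding is_bisim_def choices_def by blast
  show ?thesis
  proof
    show "d \<in> choices I t" using d by (simp add: choices_def)
    fix a
    have "mixture d (d a)"
      unfolding mixture_def
    proof (intro exI[of _ "return_pmf a"] allI)
      show "pmf (d a) s' = (\<Sum>b\<in>UNIV. pmf (return_pmf a) b * pmf (d b) s')" for s'
        using av_return[of a "\<lambda>b. pmf (d b) s'"] by (simp add: av_def)
    qed
    then obtain \<mu> where "mixture c \<mu>"
      and prob: "\<And>C. C \<in> UNIV // R \<Longrightarrow> measure_pmf.prob \<mu> C = measure_pmf.prob (d a) C"
      using match by blast
    then obtain \<rho> where \<rho>: "\<And>s'. pmf \<mu> s' = (\<Sum>b\<in>UNIV. pmf \<rho> b * pmf (c b) s')"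
      by (auto simp: mixture_def)
    have "av (d a) U = av \<rho> (\<lambda>b. av (c b) U)" if "\<forall>x y. (x, y) \<in> R \<longrightarrow> U x = U y" for U
      using av_mixture[OF \<rho>, of U] av_eq_if_class_prob_eq[OF R prob, of U] that by simp
    then show "\<exists>\<rho>. \<forall>U. (\<forall>x y. (x, y) \<in> R \<longrightarrow> U x = U y) \<longrightarrow> av (d a) U = av \<rho> (\<lambda>b. av (c b) U)"
      by blast
  qed
qed

text \<open>The value of a fixed nature against the scheduler's best reply. Pure actions suffice,
  since a weighted average over actions never exceeds its largest term.\<close>

primrec best :: "'s::finite set \<Rightarrow> ('s \<Rightarrow> real) \<Rightarrow> ('s \<Rightarrow> real) \<Rightarrow> nat
    \<Rightarrow> ('s list \<Rightarrow> 'a::finite \<Rightarrow> 's pmf) \<Rightarrow> 's \<Rightarrow> real" where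
  "best K e g 0 \<pi> s = g s"
| "best K e g (Suc n) \<pi> s = (if s \<in> K then e s
     else Max (range (\<lambda>a. av (\<pi> [s] a) (best K e g n (after s \<pi>)))))"

lemma best_cong:
  assumes "\<And>v. \<pi> (s # v) = \<pi>' (s # v)"
  shows "best K e g n \<pi> s = best K e g n \<pi>' s"
  using assms
proof (induction n arbitrary: \<pi> \<pi>' s)
  case (Suc n)
  have "best K e g n (after s \<pi>) = best K e g n (after s \<pi>')"
    by (intro ext Suc.IH) (simp_all add: after_def Suc.prems)
  with Suc.prems show ?case by simp
qed simp

lemma best_after_glue [simp]:
  "best K e g n (after s (glue c j)) = (\<lambda>x. best K e g n (j x) x)"
  by (rule ext, rule best_cong) simp_all

lemma val_le_best: "val K e g n \<sigma> \<pi> s \<le> best K e g n \<pi> s"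
proof (induction n arbitrary: \<sigma> \<pi> s)
  case (Suc n)
  have "av (\<pi> [s] a) (val K e g n (after s \<sigma>) (after s \<pi>))
      \<le> Max (range (\<lambda>a. av (\<pi> [s] a) (best K e g n (after s \<pi>))))" for a
    by (rule order_trans[OF av_mono[OF Suc.IH]]) simp
  then show ?case by (auto intro: av_le)
qed simp

lemma Max_range_attained:
  fixes f :: "'a::finite \<Rightarrow> real"
  obtains a where "Max (range f) = f a"
proof -
  have "Max (range f) \<in> range f" by (rule Max_in) auto
  then show ?thesis using that by (auto simp: image_iff)
qed

lemma best_attained:
  fixes \<pi> :: "'s::finite list \<Rightarrow> 'a::finite \<Rightarrow> 's pmf"
  shows "\<exists>\<sigma>. val K e g n \<sigma> \<pi> s = best K e g n \<pi> s"
proof (induction n arbitrary: \<pi> s)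
  case (Suc n)
  obtain k where k: "\<And>x. val K e g n (k x) (after s \<pi>) x = best K e g n (after s \<pi>) x"
    using Suc.IH by metis
  obtain a where a: "Max (range (\<lambda>a. av (\<pi> [s] a) (best K e g n (after s \<pi>))))
      = av (\<pi> [s] a) (best K e g n (after s \<pi>))"
    using Max_range_attained by blast
  show ?case
    by (rule exI[of _ "glue (\<lambda>_. return_pmf a) k"]) (simp add: k a)
qed simp

lemma best_transfer:
  fixes I :: "'s::finite \<Rightarrow> 'a::finite \<Rightarrow> 's \<Rightarrow> real set"
  assumes imdp: "is_IMDP I" and bisim: "is_bisim L I R"
    and inv: "\<And>x y. (x, y) \<in> R \<Longrightarrow> (x \<in> K \<longleftrightarrow> y \<in> K) \<and> e x = e y \<and> g x = g y"
    and "(s, t) \<in> R" "is_nature I \<pi>"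
  shows "\<exists>\<pi>'. is_nature I \<pi>' \<and> best K e g n \<pi>' t \<le> best K e g n \<pi> s"
  using assms(4,5)
proof (induction n arbitrary: \<pi> s t)
  case 0
  then show ?case using inv by fastforce
next
  case (Suc n)
  have R: "equiv UNIV R" using bisim by (simp add: is_bisim_def)
  define b where "b = best K e g n (after s \<pi>)"
  \<comment> \<open>The continuation values \<open>b\<close> need not be invariant, as a nature may
    act differently in bisimilar states. Their class minimum \<open>u\<close> is invariant, so it
    can be passed through \<open>match\<close>.\<close>
  define u where "u x = Min (b ` R `` {x})" for x
  have self: "x \<in> R `` {x}" for x
    using R by (auto simp: equiv_def refl_on_def)
  have u_le: "u x \<le> b x" for x
    unfolding u_def using self[of x] by (intro Min_le) auto
  have u_inv: "\<forall>x y. (x, y) \<in> R \<longrightarrow> u x = u y"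
    using R by (simp add: u_def equiv_class_eq)
  have "\<exists>\<pi>'. is_nature I \<pi>' \<and> best K e g n \<pi>' x \<le> u x" for x
  proof -
    have "u x \<in> b ` R `` {x}"
      unfolding u_def using self[of x] by (intro Min_in) auto
    then obtain z where z: "(x, z) \<in> R" "u x = b z" by auto
    then have "(z, x) \<in> R" using R by (auto simp: equiv_def sym_def)
    from Suc.IH[OF this is_nature_after[OF Suc.prems(2)], of s] show ?thesis
      by (simp add: z b_def)
  qed
  then obtain j where j: "\<And>x. is_nature I (j x)" "\<And>x. best K e g n (j x) x \<le> u x"
    by metis
  obtain d where d: "d \<in> choices I t"
    and match: "\<And>a. \<exists>\<rho> :: 'a pmf. \<forall>U. (\<forall>x y. (x, y) \<in> R \<longrightarrow> U x = U y)
      \<longrightarrow> av (d a) U = av \<rho> (\<lambda>b. av (\<pi> [s] b) U)"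
    using bisim_choice_match[OF bisim Suc.prems(1) nature_choices[OF Suc.prems(2)]] by metis
  \<comment> \<open>Only the first move at \<open>t\<close> matters; \<open>c0\<close> fills in
    legal first moves elsewhere.\<close>
  obtain c0 where c0: "\<And>x. c0 x \<in> choices I x"
    using choices_selection[OF imdp] by blast
  let ?p = "glue (\<lambda>x. if x = t then d else c0 x) j"
  have "av (d a) (\<lambda>x. best K e g n (j x) x) \<le> Max (range (\<lambda>a. av (\<pi> [s] a) b))" for a
  proof -
    obtain \<rho> :: "'a pmf" where \<rho>: "av (d a) u = av \<rho> (\<lambda>b. av (\<pi> [s] b) u)"
      using match[of a] u_inv by blast
    have "av (d a) (\<lambda>x. best K e g n (j x) x) \<le> av (d a) u"
      by (intro av_mono j)
    also have "\<dots> \<le> Max (range (\<lambda>a. av (\<pi> [s] a) b))"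
      unfolding \<rho>
    proof (rule av_le)
      fix a'
      show "av (\<pi> [s] a') u \<le> Max (range (\<lambda>a. av (\<pi> [s] a) b))"
        by (rule order_trans[OF av_mono[OF u_le]]) simp
    qed
    finally show ?thesis .
  qed
  then have "best K e g (Suc n) ?p t \<le> best K e g (Suc n) \<pi> s"
    using inv[OF Suc.prems(1)] by (auto simp: b_def)
  moreover have "is_nature I ?p"
    using c0 d j by (intro is_nature_glue) auto
  ultimately show ?case by blast
qed

text \<open>At a finite horizon the scheduler's extremal replies to \<open>\<pi>\<close> are
  attained. The hypothesis at these two replies therefore bounds every reply to the transferred
  nature, for strict and non-strict comparisons alike.\<close>

lemma val_cmp_transfer:
  fixes I :: "'s::finite \<Rightarrow> 'a::finite \<Rightarrow> 's \<Rightarrow> real set" and c :: cmp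
  assumes imdp: "is_IMDP I" and bisim: "is_bisim L I R"
    and inv: "\<And>x y. (x, y) \<in> R \<Longrightarrow> (x \<in> K \<longleftrightarrow> y \<in> K) \<and> e x = e y \<and> g x = g y"
    and st: "(s, t) \<in> R"
    and ex: "\<exists>\<pi>. is_nature I \<pi> \<and> (\<forall>\<sigma>::'s list \<Rightarrow> 'a pmf. cmp_holds c (val K e g n \<sigma> \<pi> s) p)"
  shows "\<exists>\<pi>. is_nature I \<pi> \<and> (\<forall>\<sigma>::'s list \<Rightarrow> 'a pmf. cmp_holds c (val K e g n \<sigma> \<pi> t) p)"
proof -
  from ex obtain \<pi> where \<pi>: "is_nature I \<pi>"
    and \<sigma>: "\<And>\<sigma>::'s list \<Rightarrow> 'a pmf. cmp_holds c (val K e g n \<sigma> \<pi> s) p" by blast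
  let ?e = "\<lambda>s. - e s" and ?g = "\<lambda>s. - g s"
  obtain \<pi>1 where \<pi>1: "is_nature I \<pi>1" "best K e g n \<pi>1 t \<le> best K e g n \<pi> s"
    using best_transfer[OF imdp bisim inv st \<pi>] by blast
  have "(x \<in> K \<longleftrightarrow> y \<in> K) \<and> ?e x = ?e y \<and> ?g x = ?g y" if "(x, y) \<in> R" for x y
    using inv[OF that] by simp
  then obtain \<pi>2 where \<pi>2: "is_nature I \<pi>2" "best K ?e ?g n \<pi>2 t \<le> best K ?e ?g n \<pi> s"
    using best_transfer[OF imdp bisim _ st \<pi>, of K ?e ?g] by blast
  obtain \<sigma>1 \<sigma>2 where 1: "val K e g n \<sigma>1 \<pi> s = best K e g n \<pi> s"
    and 2: "val K ?e ?g n \<sigma>2 \<pi> s = best K ?e ?g n \<pi> s"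
    using best_attained by blast
  have up: "val K e g n \<sigma> \<pi>1 t \<le> val K e g n \<sigma>1 \<pi> s" for \<sigma>
    using val_le_best[of K e g n \<sigma> \<pi>1 t] \<pi>1(2) 1 by simp
  have down: "val K e g n \<sigma>2 \<pi> s \<le> val K e g n \<sigma> \<pi>2 t" for \<sigma>
    using val_le_best[of K ?e ?g n \<sigma> \<pi>2 t] \<pi>2(2) 2 by (simp add: val_uminus)
  show ?thesis
  proof (cases c)
    case CLe
    then show ?thesis using up \<sigma>[of \<sigma>1] \<pi>1(1) by (intro exI[of _ \<pi>1]) (auto intro: order_trans)
  next
    case CLt
    then show ?thesis using up \<sigma>[of \<sigma>1] \<pi>1(1) by (intro exI[of _ \<pi>1]) (auto intro: le_less_trans)
  next
    case CGe
    then show ?thesis using down \<sigma>[of \<sigma>2] \<pi>2(1) by (intro exI[of _ \<pi>2]) (auto intro: order_trans)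
  next
    case CGt
    then show ?thesis using down \<sigma>[of \<sigma>2] \<pi>2(1) by (intro exI[of _ \<pi>2]) (auto intro: less_le_trans)
  qed
qed

section \<open>Probabilities of path formulas\<close>

text \<open>The event whose probability is \<open>val\<close> with indicator payoffs:
  \<open>E\<close> decides on entering \<open>K\<close>, and \<open>T\<close> decides at the cutoff,
  where \<open>K\<close> is not consulted.\<close>

primrec payoff_event :: "'s set \<Rightarrow> 's set \<Rightarrow> 's set \<Rightarrow> nat \<Rightarrow> 's stream \<Rightarrow> bool" where
  "payoff_event K E T 0 \<omega> \<longleftrightarrow> shd \<omega> \<in> T"
| "payoff_event K E T (Suc n) \<omega> \<longleftrightarrow> (if shd \<omega> \<in> K then shd \<omega> \<in> E else payoff_event K E T n (stl \<omega>))"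

lemma payoff_event_measurable [measurable]:
  "Measurable.pred (stream_space (count_space (UNIV :: 's::finite set))) (payoff_event K E T n)"
proof (induction n)
  case 0
  show ?case by simp measurable
next
  case (Suc n)
  note Suc [measurable]
  show ?case by simp measurable
qed

text \<open>The prefix \<open>u\<close> is carried along because \<open>val\<close> shifts the
  strategies whereas \<open>P\<close> lives on full paths. Multiplying by the probability of the
  cylinder, instead of conditioning, also covers cylinders of probability zero.\<close>

lemma measure_cyl_payoff_event:
  fixes \<sigma> :: "'s::finite list \<Rightarrow> 'a::finite pmf"
  assumes P: "is_path_measure \<sigma> \<pi> s P"
  shows "measure P (cyl (u @ [x]) \<inter> {\<omega>. payoff_event K E T n (sdrop (length u) \<omega>)})
    = measure P (cyl (u @ [x])) * val K (indicator E) (indicator T) n (\<lambda>v. \<sigma> (u @ v)) (\<lambda>v. \<pi> (u @ v)) x"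
proof (induction n arbitrary: u x)
  case 0
  have "cyl (u @ [x]) \<inter> {\<omega>. payoff_event K E T 0 (sdrop (length u) \<omega>)} = (if x \<in> T then cyl (u @ [x]) else {})"
    by (auto simp: cyl_snoc)
  then show ?case by simp
next
  case (Suc n)
  have sets_P: "sets P = sets (stream_space (count_space UNIV))"
    using P by (simp add: is_path_measure_def)
  interpret prob_space P using P by (simp add: is_path_measure_def)
  let ?w = "u @ [x]"
  show ?case
  proof (cases "x \<in> K")
    case True
    have "cyl ?w \<inter> {\<omega>. payoff_event K E T (Suc n) (sdrop (length u) \<omega>)} = (if x \<in> E then cyl ?w else {})"
      using True by (auto simp: cyl_snoc)
    then show ?thesis using True by simp
  next
    case False
    let ?B = "\<lambda>y. cyl (?w @ [y]) \<inter> {\<omega>. payoff_event K E T n (sdrop (length ?w) \<omega>)}"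
    let ?v = "val K (indicator E) (indicator T) n (\<lambda>v. \<sigma> (?w @ v)) (\<lambda>v. \<pi> (?w @ v))"
    have "cyl ?w \<inter> {\<omega>. payoff_event K E T (Suc n) (sdrop (length u) \<omega>)}
        = cyl ?w \<inter> {\<omega>. payoff_event K E T n (sdrop (length ?w) \<omega>)}"
    proof -
      have "payoff_event K E T (Suc n) (sdrop (length u) \<omega>) \<longleftrightarrow> payoff_event K E T n (sdrop (length ?w) \<omega>)"
        if "\<omega> \<in> cyl ?w" for \<omega>
      proof -
        have "shd (sdrop (length u) \<omega>) = x" using that by (simp add: cyl_snoc)
        moreover have "sdrop (length ?w) \<omega> = stl (sdrop (length u) \<omega>)" by simp
        ultimately show ?thesis using False by simp
      qed
      then show ?thesis by blast
    qed
    also have "\<dots> = (\<Union>y. ?B y)"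
      unfolding cyl_snoc[of ?w] by blast
    also have "measure P \<dots> = (\<Sum>y\<in>UNIV. measure P (?B y))"
    proof (rule finite_measure_finite_Union)
      have "{\<omega> \<in> space (stream_space (count_space UNIV)). payoff_event K E T n (sdrop (length ?w) \<omega>)}
          \<in> sets (stream_space (count_space UNIV))"
        by measurable
      then have "{\<omega>. payoff_event K E T n (sdrop (length ?w) \<omega>)} \<in> sets P"
        by (simp add: sets_P space_stream_space)
      moreover have "cyl (?w @ [y]) \<in> sets P" for y
        unfolding sets_P by (rule cyl_measurable)
      ultimately show "range ?B \<subseteq> sets P" by blast
      show "disjoint_family ?B"
        unfolding disjoint_family_on_def cyl_snoc[of ?w] by blast
    qed simp
    also have "\<dots> = (\<Sum>y\<in>UNIV. measure P (cyl (?w @ [y])) * ?v y)"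
      using Suc.IH[of ?w] by simp
    also have "\<dots> = (\<Sum>y\<in>UNIV. measure P (cyl ?w) * ((\<Sum>a\<in>UNIV. pmf (\<sigma> ?w) a * pmf (\<pi> ?w a) y) * ?v y))"
    proof (rule sum.cong[OF refl])
      fix y
      have "measure P (cyl (?w @ [y])) = measure P (cyl ?w) * (\<Sum>a\<in>UNIV. pmf (\<sigma> ?w) a * pmf (\<pi> ?w a) y)"
        using P unfolding is_path_measure_def by blast
      then show "measure P (cyl (?w @ [y])) * ?v y
          = measure P (cyl ?w) * ((\<Sum>a\<in>UNIV. pmf (\<sigma> ?w) a * pmf (\<pi> ?w a) y) * ?v y)"
        by (simp only: mult.assoc)
    qed
    also have "\<dots> = measure P (cyl ?w) * (\<Sum>y\<in>UNIV. \<Sum>a\<in>UNIV. pmf (\<sigma> ?w) a * pmf (\<pi> ?w a) y * ?v y)"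
      by (simp only: sum_distrib_left[of "measure P (cyl ?w)"] sum_distrib_right)
    also have "(\<Sum>y\<in>UNIV. \<Sum>a\<in>UNIV. pmf (\<sigma> ?w) a * pmf (\<pi> ?w a) y * ?v y)
        = av (\<sigma> ?w) (\<lambda>a. av (\<pi> ?w a) ?v)"
      by (subst sum.swap) (simp add: av_def sum_distrib_left mult.assoc)
    finally show ?thesis
      using False by (simp add: after_def[abs_def])
  qed
qed

lemma Pr_payoff_event:
  "measure (Pr \<sigma> \<pi> s) {\<omega>. payoff_event K E T n \<omega>} = val K (indicator E) (indicator T) n \<sigma> \<pi> s"
proof -
  have P: "is_path_measure \<sigma> \<pi> s (Pr \<sigma> \<pi> s)"
    by (rule is_path_measure_Pr)
  then interpret prob_space "Pr \<sigma> \<pi> s" by (simp add: is_path_measure_def)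
  have sets_P: "sets (Pr \<sigma> \<pi> s) = sets (stream_space (count_space UNIV))"
    using P by (simp add: is_path_measure_def)
  have one: "measure (Pr \<sigma> \<pi> s) (cyl [s]) = 1"
    using P by (simp add: is_path_measure_def)
  let ?A = "{\<omega>. payoff_event K E T n \<omega>}"
  have "{\<omega> \<in> space (stream_space (count_space UNIV)). payoff_event K E T n \<omega>}
          \<in> sets (stream_space (count_space UNIV))"
    by measurable
  then have A: "?A \<in> sets (Pr \<sigma> \<pi> s)"
    by (simp add: sets_P space_stream_space)
  have C: "cyl [s] \<in> sets (Pr \<sigma> \<pi> s)"
    unfolding sets_P by (rule cyl_measurable)
  have "AE \<omega> in Pr \<sigma> \<pi> s. \<omega> \<in> cyl [s]"
    using one C by (simp add: prob_eq_1)
  then have "measure (Pr \<sigma> \<pi> s) ?A = measure (Pr \<sigma> \<pi> s) (cyl [s] \<inter> ?A)"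
    using A C by (intro measure_eq_AE) auto
  also have "\<dots> = val K (indicator E) (indicator T) n \<sigma> \<pi> s"
    using measure_cyl_payoff_event[OF P, of "[]" s K E T n] one by simp
  finally show ?thesis .
qed

text \<open>The index counts inspected states, not transitions: index 0 sees nothing and yields 0,
  and index \<open>k\<close> is the bounded until with bound \<open>k\<close> when states are
  numbered from 1.\<close>

definition uval :: "'s::finite set \<Rightarrow> 's set \<Rightarrow> nat \<Rightarrow> ('s list \<Rightarrow> 'a::finite pmf)
    \<Rightarrow> ('s list \<Rightarrow> 'a \<Rightarrow> 's pmf) \<Rightarrow> 's \<Rightarrow> real" where
  "uval F G = val (G \<union> - F) (indicator G) (\<lambda>_. 0)"

lemma uval_0 [simp]: "uval F G 0 \<sigma> \<pi> s = 0"
  by (simp add: uval_def)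

lemma uval_Suc: "uval F G (Suc n) \<sigma> \<pi> s = (if s \<in> G then 1 else if s \<notin> F then 0
     else av (\<sigma> [s]) (\<lambda>a. av (\<pi> [s] a) (uval F G n (after s \<sigma>) (after s \<pi>))))"
  by (simp add: uval_def)

lemma uval_nonneg: "0 \<le> uval F G n \<sigma> \<pi> s"
  by (induction n arbitrary: \<sigma> \<pi> s) (auto simp: uval_Suc intro!: av_ge)

lemma uval_le_1: "uval F G n \<sigma> \<pi> s \<le> 1"
  by (induction n arbitrary: \<sigma> \<pi> s) (auto simp: uval_Suc intro!: av_le)

lemma uval_le_Suc: "uval F G n \<sigma> \<pi> s \<le> uval F G (Suc n) \<sigma> \<pi> s"
proof (induction n arbitrary: \<sigma> \<pi> s)
  case 0
  then show ?case using uval_nonneg[of F G "Suc 0" \<sigma> \<pi> s] by simp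
next
  case (Suc n)
  show ?case
    unfolding uval_Suc[of F G "Suc n"]
    by (subst uval_Suc) (auto intro!: av_mono Suc.IH)
qed

definition reach :: "'s::finite set \<Rightarrow> 's set \<Rightarrow> ('s list \<Rightarrow> 'a::finite pmf)
    \<Rightarrow> ('s list \<Rightarrow> 'a \<Rightarrow> 's pmf) \<Rightarrow> 's \<Rightarrow> real" where
  "reach F G \<sigma> \<pi> s = lim (\<lambda>n. uval F G n \<sigma> \<pi> s)"

lemma reach_tendsto: "(\<lambda>n. uval F G n \<sigma> \<pi> s) \<longlonglongrightarrow> reach F G \<sigma> \<pi> s"
proof -
  have "incseq (\<lambda>n. uval F G n \<sigma> \<pi> s)"
    by (rule incseq_SucI) (rule uval_le_Suc)
  then have "convergent (\<lambda>n. uval F G n \<sigma> \<pi> s)"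
    by (rule incseq_convergent[where B = 1]) (auto simp: uval_le_1 convergent_def)
  then show ?thesis
    unfolding reach_def by (simp add: convergent_LIMSEQ_iff)
qed

lemma uval_le_reach: "uval F G n \<sigma> \<pi> s \<le> reach F G \<sigma> \<pi> s"
  by (rule incseq_le[OF incseq_SucI reach_tendsto]) (rule uval_le_Suc)

lemma reach_le: "(\<And>n. uval F G n \<sigma> \<pi> s \<le> c) \<Longrightarrow> reach F G \<sigma> \<pi> s \<le> c"
  using reach_tendsto by (rule LIMSEQ_le_const2) blast

lemma reach_nonneg: "0 \<le> reach F G \<sigma> \<pi> s"
  using uval_le_reach[of F G 0] by simp

lemma reach_unfold: "reach F G \<sigma> \<pi> s = (if s \<in> G then 1 else if s \<notin> F then 0
     else av (\<sigma> [s]) (\<lambda>a. av (\<pi> [s] a) (reach F G (after s \<sigma>) (after s \<pi>))))"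
proof -
  have "(\<lambda>n. uval F G (Suc n) \<sigma> \<pi> s) \<longlonglongrightarrow> (if s \<in> G then 1 else if s \<notin> F then 0
     else av (\<sigma> [s]) (\<lambda>a. av (\<pi> [s] a) (reach F G (after s \<sigma>) (after s \<pi>))))"
    by (auto simp: uval_Suc intro!: av_tendsto reach_tendsto)
  then show ?thesis
    by (rule LIMSEQ_unique[OF LIMSEQ_Suc[OF reach_tendsto]])
qed

lemma reach_cong:
  assumes "\<And>v. \<sigma> (s # v) = \<sigma>' (s # v)" "\<And>v. \<pi> (s # v) = \<pi>' (s # v)"
  shows "reach F G \<sigma> \<pi> s = reach F G \<sigma>' \<pi>' s"
  unfolding reach_def uval_def by (simp only: val_cong[of \<sigma> s \<sigma>' \<pi> \<pi>', OF assms])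

lemma reach_after_glue_sched [simp]:
  "reach F G (after s (glue \<rho> k)) \<pi> = (\<lambda>x. reach F G (k x) \<pi> x)"
  by (rule ext, rule reach_cong) simp_all

lemma payoff_event_next: "payoff_event {} {} T 1 \<omega> \<longleftrightarrow> \<omega> !! 1 \<in> T"
  by simp

lemma payoff_event_until:
  "payoff_event (G \<union> - F) G {} k \<omega> \<longleftrightarrow>
    (\<exists>i. 1 \<le> i \<and> i \<le> k \<and> \<omega> !! (i - 1) \<in> G \<and> (\<forall>j. 1 \<le> j \<and> j < i \<longrightarrow> \<omega> !! (j - 1) \<in> F))"
proof -
  \<comment> \<open>Positions counted from 1 are converted to stream indices counted from 0, so
    \<open>i \<le> k\<close> becomes \<open>i < k\<close>.\<close>
  have reindex: "(\<exists>i. 1 \<le> i \<and> i \<le> k \<and> \<omega> !! (i - 1) \<in> G \<and> (\<forall>j. 1 \<le> j \<and> j < i \<longrightarrow> \<omega> !! (j - 1) \<in> F))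
      \<longleftrightarrow> (\<exists>i<k. \<omega> !! i \<in> G \<and> (\<forall>j<i. \<omega> !! j \<in> F))" (is "?L \<longleftrightarrow> ?R")
  proof
    assume ?L
    then obtain i where "1 \<le> i" "i \<le> k" "\<omega> !! (i - 1) \<in> G"
      and F: "\<And>j. 1 \<le> j \<Longrightarrow> j < i \<Longrightarrow> \<omega> !! (j - 1) \<in> F" by blast
    then show ?R
      using F[of "Suc j" for j] by (intro exI[of _ "i - 1"]) auto
  next
    assume ?R
    then obtain i where "i < k" "\<omega> !! i \<in> G" "\<And>j. j < i \<Longrightarrow> \<omega> !! j \<in> F" by blast
    then show ?L
      by (intro exI[of _ "Suc i"]) auto
  qed
  show ?thesis
    unfolding reindex
  proof (induction k arbitrary: \<omega>)
    case (Suc k)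
    have "(\<exists>i<Suc k. \<omega> !! i \<in> G \<and> (\<forall>j<i. \<omega> !! j \<in> F)) \<longleftrightarrow>
        shd \<omega> \<in> G \<or> (shd \<omega> \<in> F \<and> (\<exists>i<k. stl \<omega> !! i \<in> G \<and> (\<forall>j<i. stl \<omega> !! j \<in> F)))"
      by (simp add: Ex_less_Suc2 All_less_Suc2) blast
    then show ?case
      using Suc.IH[of "stl \<omega>"] by auto
  qed simp
qed

lemma Pr_next: "measure (Pr \<sigma> \<pi> s) {\<omega>. \<omega> !! 1 \<in> T} = val {} (indicator {}) (indicator T) 1 \<sigma> \<pi> s"
  using Pr_payoff_event[of \<sigma> \<pi> s "{}" "{}" T 1] by (simp only: payoff_event_next)

lemma Pr_bounded_until:
  "measure (Pr \<sigma> \<pi> s) {\<omega>. \<exists>i. 1 \<le> i \<and> i \<le> k \<and> \<omega> !! (i - 1) \<in> G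
      \<and> (\<forall>j. 1 \<le> j \<and> j < i \<longrightarrow> \<omega> !! (j - 1) \<in> F)} = uval F G k \<sigma> \<pi> s"
  using Pr_payoff_event[of \<sigma> \<pi> s "G \<union> - F" G "{}" k]
  by (simp add: payoff_event_until uval_def indicator_def[of "{}", abs_def])

lemma Pr_until:
  "measure (Pr \<sigma> \<pi> s) {\<omega>. \<exists>k. \<exists>i. 1 \<le> i \<and> i \<le> k \<and> \<omega> !! (i - 1) \<in> G
      \<and> (\<forall>j. 1 \<le> j \<and> j < i \<longrightarrow> \<omega> !! (j - 1) \<in> F)} = reach F G \<sigma> \<pi> s"
proof -
  have P: "is_path_measure \<sigma> \<pi> s (Pr \<sigma> \<pi> s)"
    by (rule is_path_measure_Pr)
  then interpret prob_space "Pr \<sigma> \<pi> s" by (simp add: is_path_measure_def)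
  have sets_P: "sets (Pr \<sigma> \<pi> s) = sets (stream_space (count_space UNIV))"
    using P by (simp add: is_path_measure_def)
  let ?B = "\<lambda>k. {\<omega>. \<exists>i. 1 \<le> i \<and> i \<le> k \<and> \<omega> !! (i - 1) \<in> G \<and> (\<forall>j. 1 \<le> j \<and> j < i \<longrightarrow> \<omega> !! (j - 1) \<in> F)}"
  have "{\<omega> \<in> space (stream_space (count_space UNIV)). payoff_event (G \<union> - F) G {} k \<omega>}
          \<in> sets (stream_space (count_space UNIV))" for k
    by measurable
  then have "range ?B \<subseteq> sets (Pr \<sigma> \<pi> s)"
    by (auto simp: sets_P space_stream_space payoff_event_until)
  moreover have "incseq ?B"
    by (rule incseq_SucI) force
  ultimately have "(\<lambda>k. measure (Pr \<sigma> \<pi> s) (?B k)) \<longlonglongrightarrow> measure (Pr \<sigma> \<pi> s) (\<Union>k. ?B k)"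
    by (rule finite_Lim_measure_incseq)
  then have "(\<lambda>k. uval F G k \<sigma> \<pi> s) \<longlonglongrightarrow> measure (Pr \<sigma> \<pi> s) (\<Union>k. ?B k)"
    by (simp only: Pr_bounded_until)
  then have "measure (Pr \<sigma> \<pi> s) (\<Union>k. ?B k) = reach F G \<sigma> \<pi> s"
    by (rule LIMSEQ_unique) (rule reach_tendsto)
  moreover have "(\<Union>k. ?B k) = {\<omega>. \<exists>k. \<omega> \<in> ?B k}" by blast
  ultimately show ?thesis by simp
qed

section \<open>Values of the until game\<close>

lemma choice2: "(\<And>x y. \<exists>z. P x y z) \<Longrightarrow> \<exists>f. \<forall>x y. P x y (f x y)"
  by metis

lemma finite_pos_lower_bound:
  fixes X :: "real set"
  assumes "finite X" "\<And>x. x \<in> X \<Longrightarrow> 0 < x"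
  shows "\<exists>\<eta>>0. \<eta> \<le> 1 \<and> (\<forall>x\<in>X. \<eta> \<le> x)"
proof (intro exI conjI ballI)
  show "0 < Min (insert 1 X)" using assms by (subst Min_gr_iff) auto
  show "Min (insert 1 X) \<le> 1" using assms by simp
  show "Min (insert 1 X) \<le> x" if "x \<in> X" for x using assms that by simp
qed

text \<open>With \<open>\<epsilon> = 0\<close> the first clause is monotonicity. With positive
  \<open>\<epsilon>\<close> it is one-sided nonexpansiveness in the sup norm, which supplies the
  continuity needed for the limit of the iterates to be a fixpoint. The other two clauses keep the
  iterates between 0 and 1.\<close>

definition nonexp :: "(('s \<Rightarrow> real) \<Rightarrow> 's \<Rightarrow> real) \<Rightarrow> bool" where
  "nonexp \<Phi> \<longleftrightarrow> (\<forall>U W \<epsilon> s. 0 \<le> \<epsilon> \<longrightarrow> (\<forall>x. U x \<le> W x + \<epsilon>) \<longrightarrow> \<Phi> U s \<le> \<Phi> W s + \<epsilon>)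
     \<and> (\<forall>s. 0 \<le> \<Phi> (\<lambda>_. 0) s) \<and> (\<forall>s. \<Phi> (\<lambda>_. 1) s \<le> 1)"

definition approx :: "(('s \<Rightarrow> real) \<Rightarrow> 's \<Rightarrow> real) \<Rightarrow> nat \<Rightarrow> 's \<Rightarrow> real" where
  "approx \<Phi> n = (\<Phi> ^^ n) (\<lambda>_. 0)"

definition fixval :: "(('s \<Rightarrow> real) \<Rightarrow> 's \<Rightarrow> real) \<Rightarrow> 's \<Rightarrow> real" where
  "fixval \<Phi> s = lim (\<lambda>n. approx \<Phi> n s)"

lemma approx_0 [simp]: "approx \<Phi> 0 = (\<lambda>_. 0)"
  by (simp add: approx_def)

lemma approx_Suc: "approx \<Phi> (Suc n) = \<Phi> (approx \<Phi> n)"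
  by (simp add: approx_def)

context
  fixes \<Phi> :: "('s::finite \<Rightarrow> real) \<Rightarrow> 's \<Rightarrow> real"
  assumes ne: "nonexp \<Phi>"
begin

lemma nonexp_shift: "0 \<le> \<epsilon> \<Longrightarrow> (\<And>x. U x \<le> W x + \<epsilon>) \<Longrightarrow> \<Phi> U s \<le> \<Phi> W s + \<epsilon>"
  using ne by (simp add: nonexp_def)

lemma nonexp_mono: "(\<And>x. U x \<le> W x) \<Longrightarrow> \<Phi> U s \<le> \<Phi> W s"
  using nonexp_shift[of 0 U W s] by simp

lemma approx_le_Suc: "approx \<Phi> n s \<le> approx \<Phi> (Suc n) s"
proof (induction n arbitrary: s)
  case 0
  show ?case using ne by (simp add: approx_Suc nonexp_def)
next
  case (Suc n)
  show ?case
    unfolding approx_Suc[of \<Phi> "Suc n"] by (subst approx_Suc) (intro nonexp_mono Suc.IH)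
qed

lemma approx_le_1: "approx \<Phi> n s \<le> 1"
proof (induction n arbitrary: s)
  case (Suc n)
  have "approx \<Phi> (Suc n) s \<le> \<Phi> (\<lambda>_. 1) s"
    unfolding approx_Suc by (intro nonexp_mono Suc.IH)
  also have "\<dots> \<le> 1" using ne by (simp add: nonexp_def)
  finally show ?case .
qed simp

lemma fixval_tendsto: "(\<lambda>n. approx \<Phi> n s) \<longlonglongrightarrow> fixval \<Phi> s"
proof -
  have "incseq (\<lambda>n. approx \<Phi> n s)"
    by (rule incseq_SucI) (rule approx_le_Suc)
  then have "convergent (\<lambda>n. approx \<Phi> n s)"
    by (rule incseq_convergent[where B = 1]) (auto simp: approx_le_1 convergent_def)
  then show ?thesis
    unfolding fixval_def by (simp add: convergent_LIMSEQ_iff)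
qed

lemma approx_le_fixval: "approx \<Phi> n s \<le> fixval \<Phi> s"
  by (rule incseq_le[OF incseq_SucI fixval_tendsto]) (rule approx_le_Suc)

lemma fixval_nonneg: "0 \<le> fixval \<Phi> s"
  using approx_le_fixval[of 0 s] by simp

lemma fixval_le_1: "fixval \<Phi> s \<le> 1"
  using fixval_tendsto by (rule LIMSEQ_le_const2) (simp add: approx_le_1)

lemma approx_uniform:
  assumes "0 < \<epsilon>"
  obtains N where "\<And>s. fixval \<Phi> s - \<epsilon> \<le> approx \<Phi> N s"
proof -
  have "\<forall>\<^sub>F n in sequentially. fixval \<Phi> s - \<epsilon> < approx \<Phi> n s" for s
    using fixval_tendsto assms by (intro order_tendstoD) auto
  then have "\<forall>\<^sub>F n in sequentially. \<forall>s\<in>UNIV. fixval \<Phi> s - \<epsilon> < approx \<Phi> n s"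
    by (intro eventually_ball_finite) auto
  then obtain N where "\<And>s. fixval \<Phi> s - \<epsilon> < approx \<Phi> N s"
    by (auto simp: eventually_sequentially)
  then show ?thesis using that by (meson less_imp_le)
qed

lemma fixval_fixpoint: "\<Phi> (fixval \<Phi>) s = fixval \<Phi> s"
proof (rule antisym)
  show "\<Phi> (fixval \<Phi>) s \<le> fixval \<Phi> s"
  proof (rule field_le_epsilon)
    fix \<epsilon> :: real assume "0 < \<epsilon>"
    then obtain N where N: "\<And>s. fixval \<Phi> s - \<epsilon> \<le> approx \<Phi> N s"
      using approx_uniform by blast
    have "\<Phi> (fixval \<Phi>) s \<le> \<Phi> (approx \<Phi> N) s + \<epsilon>"
    proof (rule nonexp_shift)
      show "fixval \<Phi> x \<le> approx \<Phi> N x + \<epsilon>" for x using N[of x] by simp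
    qed (use \<open>0 < \<epsilon>\<close> in simp)
    also have "\<Phi> (approx \<Phi> N) s \<le> fixval \<Phi> s"
      using approx_le_fixval[of "Suc N" s] by (simp add: approx_Suc)
    finally show "\<Phi> (fixval \<Phi>) s \<le> fixval \<Phi> s + \<epsilon>" by simp
  qed
  have "approx \<Phi> (Suc n) s \<le> \<Phi> (fixval \<Phi>) s" for n
    unfolding approx_Suc by (intro nonexp_mono approx_le_fixval)
  then show "fixval \<Phi> s \<le> \<Phi> (fixval \<Phi>) s"
    by (intro LIMSEQ_le_const2[OF LIMSEQ_Suc[OF fixval_tendsto]]) auto
qed

lemma fixval_least:
  assumes "\<And>s. 0 \<le> U s" "\<And>s. \<Phi> U s \<le> U s"
  shows "fixval \<Phi> s \<le> U s"
proof -
  have "approx \<Phi> n s \<le> U s" for n s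
  proof (induction n arbitrary: s)
    case 0
    show ?case using assms(1) by simp
  next
    case (Suc n)
    have "approx \<Phi> (Suc n) s \<le> \<Phi> U s"
      unfolding approx_Suc by (intro nonexp_mono Suc.IH)
    with assms(2)[of s] show ?case by simp
  qed
  then show ?thesis
    by (intro LIMSEQ_le_const2[OF fixval_tendsto]) auto
qed

lemma fixval_invariant:
  assumes "\<And>U. (\<And>x y. (x, y) \<in> R \<Longrightarrow> U x = U y) \<Longrightarrow> (\<And>x y. (x, y) \<in> R \<Longrightarrow> \<Phi> U x = \<Phi> U y)"
    and "(s, t) \<in> R"
  shows "fixval \<Phi> s = fixval \<Phi> t"
proof -
  have "(x, y) \<in> R \<Longrightarrow> approx \<Phi> n x = approx \<Phi> n y" for n x y
    by (induction n arbitrary: x y) (auto simp: approx_Suc intro: assms(1))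
  with assms(2) show ?thesis by (simp add: fixval_def)
qed

end

section \<open>One-step operators of the until game\<close>

locale until_game =
  fixes I :: "'s::finite \<Rightarrow> 'a::finite \<Rightarrow> 's \<Rightarrow> real set" and F G :: "'s set"
  assumes imdp: "is_IMDP I"
begin

text \<open>The parameter \<open>T\<close> restricts the scheduler's actions, so that unrestricted
  play and play by safe actions are instances of one operator.\<close>

definition minimax :: "('s \<Rightarrow> 'a set) \<Rightarrow> ('s \<Rightarrow> real) \<Rightarrow> 's \<Rightarrow> real" where
  "minimax T U s = (INF c\<in>choices I s. Max ((\<lambda>a. av (c a) U) ` T s))"

definition guarded :: "('s \<Rightarrow> real) \<Rightarrow> 's \<Rightarrow> real" where
  "guarded U s = (if s \<in> G then 1 else if s \<notin> F then 0 else U s)"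

definition min_op :: "('s \<Rightarrow> 'a set) \<Rightarrow> ('s \<Rightarrow> real) \<Rightarrow> 's \<Rightarrow> real" where
  "min_op T U = guarded (minimax T U)"

text \<open>The double negation is the supremum over choices of the minimum over actions; written
  this way, the facts about \<open>minimax\<close> serve both games.\<close>

definition max_op :: "('s \<Rightarrow> real) \<Rightarrow> 's \<Rightarrow> real" where
  "max_op U = guarded (\<lambda>s. - minimax (\<lambda>_. UNIV) (\<lambda>x. - U x) s)"

lemma minimax_bdd:
  assumes "T s \<noteq> {}"
  shows "bdd_below ((\<lambda>c. Max ((\<lambda>a. av (c a) U) ` T s)) ` choices I s)"
proof (rule bdd_belowI2)
  fix c
  obtain a where "a \<in> T s" using assms by blast
  have "Min (range U) \<le> av (c a) U" by (intro av_ge) simp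
  also have "\<dots> \<le> Max ((\<lambda>a. av (c a) U) ` T s)" using \<open>a \<in> T s\<close> by simp
  finally show "Min (range U) \<le> Max ((\<lambda>a. av (c a) U) ` T s)" .
qed

lemma minimax_le:
  assumes "T s \<noteq> {}" "c \<in> choices I s" "\<And>a. a \<in> T s \<Longrightarrow> av (c a) U \<le> b"
  shows "minimax T U s \<le> b"
proof -
  have "minimax T U s \<le> Max ((\<lambda>a. av (c a) U) ` T s)"
    unfolding minimax_def using assms(2) by (intro cINF_lower minimax_bdd assms(1))
  also have "\<dots> \<le> b" using assms by (subst Max_le_iff) auto
  finally show ?thesis .
qed

lemma minimax_approx:
  assumes "T s \<noteq> {}" "0 < \<epsilon>"
  obtains c where "c \<in> choices I s" "\<And>a. a \<in> T s \<Longrightarrow> av (c a) U \<le> minimax T U s + \<epsilon>"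
proof -
  have "minimax T U s < minimax T U s + \<epsilon>" using assms by simp
  then obtain c where c: "c \<in> choices I s" "Max ((\<lambda>a. av (c a) U) ` T s) < minimax T U s + \<epsilon>"
    unfolding minimax_def
    using cINF_less_iff[OF choices_nonempty[OF imdp] minimax_bdd[of T s U, OF assms(1)]] by blast
  have "av (c a) U \<le> minimax T U s + \<epsilon>" if "a \<in> T s" for a
  proof -
    have "av (c a) U \<le> Max ((\<lambda>a. av (c a) U) ` T s)" using that by simp
    with c(2) show ?thesis by simp
  qed
  with c(1) show ?thesis by (rule that)
qed

lemma minimax_attained:
  assumes "T s \<noteq> {}" "c \<in> choices I s"
  obtains a where "a \<in> T s" "\<And>b. b \<in> T s \<Longrightarrow> av (c b) U \<le> av (c a) U" "minimax T U s \<le> av (c a) U"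
proof -
  let ?M = "Max ((\<lambda>a. av (c a) U) ` T s)"
  have "?M \<in> (\<lambda>a. av (c a) U) ` T s" using assms by (intro Max_in) auto
  then obtain a where a: "a \<in> T s" "?M = av (c a) U" by auto
  have le: "av (c b) U \<le> av (c a) U" if "b \<in> T s" for b
    using that unfolding a(2)[symmetric] by simp
  show ?thesis by (rule that[OF a(1) le minimax_le[of T s c U, OF assms le]])
qed

text \<open>With \<open>T = T'\<close> this gives nonexpansiveness; with \<open>U = W\<close> and
  \<open>\<epsilon> = 0\<close> it compares restricted with unrestricted schedulers.\<close>

lemma minimax_shift:
  assumes T: "T s \<noteq> {}" "T s \<subseteq> T' s" and UW: "\<And>x. U x \<le> W x + \<epsilon>"
  shows "minimax T U s \<le> minimax T' W s + \<epsilon>"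
proof (rule field_le_epsilon)
  fix \<delta> :: real assume "0 < \<delta>"
  then obtain c where c: "c \<in> choices I s" "\<And>a. a \<in> T' s \<Longrightarrow> av (c a) W \<le> minimax T' W s + \<delta>"
    using minimax_approx[of T' s \<delta> W] T by blast
  show "minimax T U s \<le> minimax T' W s + \<epsilon> + \<delta>"
  proof (rule minimax_le[of T s c U, OF T(1) c(1)])
    fix a assume "a \<in> T s"
    have "av (c a) U \<le> av (c a) (\<lambda>x. W x + \<epsilon>)" by (intro av_mono UW)
    also have "\<dots> = av (c a) W + \<epsilon>" by (simp add: av_add)
    also have "\<dots> \<le> minimax T' W s + \<epsilon> + \<delta>" using c(2)[of a] T \<open>a \<in> T s\<close> by auto
    finally show "av (c a) U \<le> minimax T' W s + \<epsilon> + \<delta>" .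
  qed
qed

lemma minimax_const:
  assumes "T s \<noteq> {}"
  shows "minimax T (\<lambda>_. b) s = b"
proof (rule antisym)
  obtain c where "c \<in> choices I s" using choices_nonempty[OF imdp] by blast
  then show "minimax T (\<lambda>_. b) s \<le> b" using assms by (auto intro: minimax_le)
  show "b \<le> minimax T (\<lambda>_. b) s"
  proof (rule field_le_epsilon)
    fix \<epsilon> :: real assume "0 < \<epsilon>"
    obtain a where "a \<in> T s" using assms by blast
    show "b \<le> minimax T (\<lambda>_. b) s + \<epsilon>"
    proof (rule minimax_approx[of T s \<epsilon> "\<lambda>_. b", OF assms \<open>0 < \<epsilon>\<close>])
      fix c :: "'a \<Rightarrow> 's pmf"
      assume "\<And>a. a \<in> T s \<Longrightarrow> av (c a) (\<lambda>_. b) \<le> minimax T (\<lambda>_. b) s + \<epsilon>"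
      from this[OF \<open>a \<in> T s\<close>] show ?thesis by simp
    qed
  qed
qed

lemma nonexp_min_op:
  assumes "\<And>s. T s \<noteq> {}"
  shows "nonexp (min_op T)"
  unfolding nonexp_def
proof (intro conjI allI impI)
  fix U W :: "'s \<Rightarrow> real" and \<epsilon> :: real and s
  assume "0 \<le> \<epsilon>" "\<forall>x. U x \<le> W x + \<epsilon>"
  then show "min_op T U s \<le> min_op T W s + \<epsilon>"
    using minimax_shift[of T s T U W \<epsilon>] assms by (simp add: min_op_def guarded_def)
qed (simp_all add: min_op_def guarded_def minimax_const assms)

lemma nonexp_max_op: "nonexp max_op"
  unfolding nonexp_def
proof (intro conjI allI impI)
  fix U W :: "'s \<Rightarrow> real" and \<epsilon> :: real and s
  assume "0 \<le> \<epsilon>" and UW: "\<forall>x. U x \<le> W x + \<epsilon>"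
  have "minimax (\<lambda>_. UNIV) (\<lambda>x. - W x) s \<le> minimax (\<lambda>_. UNIV) (\<lambda>x. - U x) s + \<epsilon>"
  proof (rule minimax_shift)
    show "- W x \<le> - U x + \<epsilon>" for x using UW[rule_format, of x] by simp
  qed simp_all
  then show "max_op U s \<le> max_op W s + \<epsilon>"
    using \<open>0 \<le> \<epsilon>\<close> by (simp add: max_op_def guarded_def)
qed (simp_all add: max_op_def guarded_def minimax_const)

abbreviation vmin :: "'s \<Rightarrow> real" where
  "vmin \<equiv> fixval (min_op (\<lambda>_. UNIV))"

abbreviation vmax :: "'s \<Rightarrow> real" where
  "vmax \<equiv> fixval max_op"

lemmas ne_min = nonexp_min_op[of "\<lambda>_. UNIV", simplified]

lemma vmin_unfold: "vmin s = guarded (minimax (\<lambda>_. UNIV) vmin) s"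
  using fixval_fixpoint[OF ne_min, of s] by (simp add: min_op_def)

lemma vmax_unfold: "vmax s = guarded (\<lambda>s. - minimax (\<lambda>_. UNIV) (\<lambda>x. - vmax x) s) s"
  using fixval_fixpoint[OF nonexp_max_op, of s] by (simp add: max_op_def)

lemma vmin_le_choice:
  assumes "s \<in> F" "s \<notin> G" "c \<in> choices I s"
  obtains a where "vmin s \<le> av (c a) vmin"
proof -
  have eq: "minimax (\<lambda>_. UNIV) vmin s = vmin s"
    using vmin_unfold[of s] assms by (simp add: guarded_def)
  show ?thesis
    by (rule minimax_attained[of "\<lambda>_. UNIV" s c vmin]) (use assms that in \<open>simp_all add: eq\<close>)
qed

lemma vmin_near_choice:
  assumes "0 < \<epsilon>"
  shows "\<exists>c. c \<in> choices I s \<and> (s \<in> F \<longrightarrow> s \<notin> G \<longrightarrow> (\<forall>a. av (c a) vmin \<le> vmin s + \<epsilon>))"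
proof -
  obtain c where c: "c \<in> choices I s" "\<And>a. av (c a) vmin \<le> minimax (\<lambda>_. UNIV) vmin s + \<epsilon>"
    by (rule minimax_approx[of "\<lambda>_. UNIV" s \<epsilon> vmin]) (use assms in simp_all)
  have "av (c a) vmin \<le> vmin s + \<epsilon>" if "s \<in> F" "s \<notin> G" for a
  proof -
    have "minimax (\<lambda>_. UNIV) vmin s = vmin s"
      using vmin_unfold[of s] that by (simp add: guarded_def)
    with c(2)[of a] show ?thesis by simp
  qed
  with c(1) show ?thesis by blast
qed

text \<open>Nature spends an error of \<open>\<epsilon> / 2 ^ k\<close> on move \<open>k\<close>, in
  total at most \<open>\<epsilon>\<close>. The resulting upper bound holds at every finite horizon,
  since the cutoff pays 0 and \<open>vmin\<close> is nonnegative, and so it passes to the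
  limit.\<close>

lemma min_near_optimal:
  assumes "0 < \<epsilon>"
  obtains \<pi> where "is_nature I \<pi>" "\<And>\<sigma> s. reach F G \<sigma> \<pi> s \<le> vmin s + \<epsilon>"
proof -
  have "\<exists>c. c \<in> choices I s \<and> (s \<in> F \<longrightarrow> s \<notin> G \<longrightarrow> (\<forall>a. av (c a) vmin \<le> vmin s + \<epsilon> / 2 ^ k))" for k :: nat and s
    using assms by (intro vmin_near_choice) simp
  from choice2[of "\<lambda>k s c. c \<in> choices I s \<and> (s \<in> F \<longrightarrow> s \<notin> G \<longrightarrow> (\<forall>a. av (c a) vmin \<le> vmin s + \<epsilon> / 2 ^ k))", OF this] obtain c where c: "\<And>k s. c k s \<in> choices I s"
    "\<And>k s a. s \<in> F \<Longrightarrow> s \<notin> G \<Longrightarrow> av (c k s a) vmin \<le> vmin s + \<epsilon> / 2 ^ k"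
    by blast
  \<comment> \<open>Here \<open>i\<close> is the number of moves already made. The next move spends
    \<open>\<epsilon> / 2 ^ Suc i\<close>, and as much remains for all later ones.\<close>
  define p where "p i w = c (i + length w) (last w)" for i w
  have after: "after s (p i) (y # v) = p (Suc i) (y # v)" for s i y v
    by (simp add: after_def p_def)
  have "uval F G n \<sigma> (p i) s \<le> vmin s + \<epsilon> / 2 ^ i" for n \<sigma> i s
  proof (induction n arbitrary: \<sigma> i s)
    case 0
    then show ?case using fixval_nonneg[OF ne_min, of s] assms by (simp add: add_nonneg_nonneg)
  next
    case (Suc n)
    show ?case
    proof (cases "s \<in> F \<and> s \<notin> G")
      case True
      have "av (p i [s] a) (uval F G n (after s \<sigma>) (after s (p i))) \<le> vmin s + \<epsilon> / 2 ^ i" for a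
      proof -
        have "uval F G n (after s \<sigma>) (after s (p i)) x \<le> vmin x + \<epsilon> / 2 ^ Suc i" for x
        proof -
          have "uval F G n (after s \<sigma>) (after s (p i)) x = uval F G n (after s \<sigma>) (p (Suc i)) x"
            unfolding uval_def by (rule val_cong) (simp_all add: after)
          then show ?thesis using Suc.IH[of "after s \<sigma>" "Suc i" x] by simp
        qed
        then have "av (p i [s] a) (uval F G n (after s \<sigma>) (after s (p i)))
            \<le> av (p i [s] a) (\<lambda>x. vmin x + \<epsilon> / 2 ^ Suc i)" by (intro av_mono)
        also have "\<dots> = av (p i [s] a) vmin + \<epsilon> / 2 ^ Suc i" by (simp add: av_add)
        also have "\<dots> \<le> vmin s + \<epsilon> / 2 ^ Suc i + \<epsilon> / 2 ^ Suc i"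
          using c(2)[of s "Suc i" a] True by (simp add: p_def)
        finally show ?thesis by simp
      qed
      then show ?thesis using True by (auto simp: uval_Suc intro: av_le)
    next
      case False
      then show ?thesis
        using vmin_unfold[of s] assms by (auto simp: uval_Suc guarded_def)
    qed
  qed
  from this[of _ _ 0] have "reach F G \<sigma> (p 0) s \<le> vmin s + \<epsilon>" for \<sigma> s
    by (intro reach_le) simp
  moreover have "is_nature I (p 0)"
    using c(1) by (simp add: is_nature_def p_def choices_def)
  ultimately show ?thesis using that by blast
qed

end

section \<open>Schedulers and near-optimal natures\<close>

context until_game begin

text \<open>Actions under which no legal distribution lowers the expected \<open>vmin\<close>.
  Target states get every action: the game is over there, while the expected value of a successor
  may well be below 1.\<close>

definition safe_actions :: "'s \<Rightarrow> 'a set" where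
  "safe_actions s = (if s \<in> G then UNIV else {a. \<forall>\<mu>\<in>Gamma I s a. vmin s \<le> av \<mu> vmin})"

text \<open>Nature chooses separately for each action. If every action could be punished, the
  punishments would combine to one choice against which no action keeps the value, contradicting the
  fixpoint equation.\<close>

lemma safe_actions_nonempty: "safe_actions s \<noteq> {}"
proof
  assume empty: "safe_actions s = {}"
  then have "s \<notin> G" by (auto simp: safe_actions_def split: if_splits)
  moreover have "s \<in> F"
  proof (rule ccontr)
    assume "s \<notin> F"
    then have "vmin s = 0" using vmin_unfold[of s] \<open>s \<notin> G\<close> by (simp add: guarded_def)
    then have "safe_actions s = UNIV"
      using \<open>s \<notin> G\<close> fixval_nonneg[OF ne_min] by (auto simp: safe_actions_def intro: av_ge)
    with empty show False by simp
  qed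
  moreover have "\<forall>a. \<exists>\<mu>. \<mu> \<in> Gamma I s a \<and> av \<mu> vmin < vmin s"
    using empty \<open>s \<notin> G\<close> by (auto simp: safe_actions_def not_le)
  then obtain c where "\<forall>a. c a \<in> Gamma I s a \<and> av (c a) vmin < vmin s"
    using choice[of "\<lambda>a \<mu>. \<mu> \<in> Gamma I s a \<and> av \<mu> vmin < vmin s"] by blast
  ultimately show False
    using vmin_le_choice[of s c] by (auto simp: choices_def not_le[symmetric])
qed

lemmas ne_safe = nonexp_min_op[of safe_actions, OF safe_actions_nonempty]

abbreviation vsafe :: "'s \<Rightarrow> real" where
  "vsafe \<equiv> fixval (min_op safe_actions)"

text \<open>If the scheduler lost value by restricting itself to safe actions, then lowering
  \<open>vmin\<close> by a small constant where the loss is largest would give a smaller pre-fixpoint: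
  there, near-optimal choices against safe actions are near-optimal for \<open>vmin\<close> as well,
  and the remaining actions leave some slack.\<close>

lemma vmin_le_vsafe: "vmin s \<le> vsafe s"
proof (rule ccontr)
  assume contra: "\<not> ?thesis"
  define d where "d = Max (range (\<lambda>s. vmin s - vsafe s))"
  have le_d: "vmin x - vsafe x \<le> d" for x
    unfolding d_def by (rule Max_ge[OF _ rangeI[of "\<lambda>s. vmin s - vsafe s" x]]) simp
  have "0 < d" using le_d[of s] contra by simp
  define D where "D = {x. vmin x - vsafe x = d}"
  obtain y where "Max (range (\<lambda>s. vmin s - vsafe s)) = vmin y - vsafe y"
    by (rule Max_range_attained)
  then have y: "y \<in> D" by (simp add: D_def d_def)
  have D_FG: "x \<in> F \<and> x \<notin> G" if "x \<in> D" for x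
    using that \<open>0 < d\<close> vmin_unfold[of x] fixval_fixpoint[OF ne_safe, of x]
    by (auto simp: D_def min_op_def guarded_def split: if_splits)
  have "\<exists>\<mu>. \<mu> \<in> Gamma I x a \<and> (x \<in> D \<longrightarrow> a \<notin> safe_actions x \<longrightarrow> av \<mu> vmin < vmin x)" for x a
  proof (cases "x \<in> D \<and> a \<notin> safe_actions x")
    case True
    then show ?thesis using D_FG[of x] by (auto simp: safe_actions_def not_le)
  next
    case False
    then show ?thesis using imdp unfolding is_IMDP_def by blast
  qed
  from choice2[of "\<lambda>x a \<mu>. \<mu> \<in> Gamma I x a \<and> (x \<in> D \<longrightarrow> a \<notin> safe_actions x \<longrightarrow> av \<mu> vmin < vmin x)", OF this]
  obtain m where m: "\<And>x a. m x a \<in> Gamma I x a"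
    "\<And>x a. x \<in> D \<Longrightarrow> a \<notin> safe_actions x \<Longrightarrow> av (m x a) vmin < vmin x"
    by blast
  \<comment> \<open>Finitely many positive gaps: \<open>d\<close> keeps the lowered function
    nonnegative, the second family bounds the loss off \<open>D\<close> by
    \<open>d - \<eta>\<close>, and the third is the slack left by punished unsafe actions.\<close>
  let ?X = "insert d ((\<lambda>x. d - (vmin x - vsafe x)) ` (- D)
    \<union> (\<lambda>(x, a). vmin x - av (m x a) vmin) ` {(x, a). x \<in> D \<and> a \<notin> safe_actions x})"
  have "0 < z" if "z \<in> ?X" for z
  proof -
    have "0 < d - (vmin x - vsafe x)" if "x \<notin> D" for x
      using that le_d[of x] by (simp add: D_def less_le)
    then show ?thesis using that \<open>0 < d\<close> m(2) by auto
  qed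
  then have "\<exists>\<eta>>0. \<eta> \<le> 1 \<and> (\<forall>z\<in>?X. \<eta> \<le> z)"
    by (intro finite_pos_lower_bound) simp_all
  then obtain \<eta> where "0 < \<eta>" and ball: "\<forall>z\<in>?X. \<eta> \<le> z" by (elim exE conjE)
  note \<eta> = bspec[OF ball]
  have \<eta>_d: "\<eta> \<le> d" by (rule \<eta>) simp
  have \<eta>_off: "vmin x \<le> vsafe x + d - \<eta>" if "x \<notin> D" for x
    using \<eta>[of "d - (vmin x - vsafe x)"] that by auto
  have \<eta>_unsafe: "av (m x a) vmin \<le> vmin x - \<eta>" if "x \<in> D" "a \<notin> safe_actions x" for x a
  proof -
    have "\<eta> \<le> vmin x - av (m x a) vmin" using that by (intro \<eta>) force
    then show ?thesis by simp
  qed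
  define U where "U x = (if x \<in> D then vmin x - \<eta> else vmin x)" for x
  have U_le: "U x \<le> vmin x" for x
    using \<open>0 < \<eta>\<close> by (simp add: U_def)
  \<comment> \<open>On \<open>D\<close> this is an equality, and off \<open>D\<close> it is the
    choice of \<open>\<eta>\<close>. It lets a near-optimal choice for \<open>vsafe\<close> serve
    for \<open>U\<close> on safe actions.\<close>
  have U_le': "U x \<le> vsafe x + (d - \<eta>)" for x
    using \<eta>_off[of x] by (cases "x \<in> D") (auto simp: U_def D_def)
  have "vmin y \<le> U y"
  proof (rule fixval_least[OF ne_min])
    show "0 \<le> U x" for x
      using fixval_nonneg[OF ne_min, of x] fixval_nonneg[OF ne_safe, of x] \<eta>_d
      by (auto simp: U_def D_def)
    show "min_op (\<lambda>_. UNIV) U x \<le> U x" for x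
    proof (cases "x \<in> D")
      case False
      have "min_op (\<lambda>_. UNIV) U x \<le> min_op (\<lambda>_. UNIV) vmin x"
        by (intro nonexp_mono[OF ne_min] U_le)
      then show ?thesis using False fixval_fixpoint[OF ne_min, of x] by (simp add: U_def)
    next
      case True
      have "minimax (\<lambda>_. UNIV) U x \<le> vmin x - \<eta>"
      proof (rule field_le_epsilon)
        fix \<epsilon> :: real assume "0 < \<epsilon>"
        have eq: "minimax safe_actions vsafe x = vsafe x"
          using fixval_fixpoint[OF ne_safe, of x] D_FG[OF True] by (simp add: min_op_def guarded_def)
        obtain c where c: "c \<in> choices I x"
          "\<And>a. a \<in> safe_actions x \<Longrightarrow> av (c a) vsafe \<le> vsafe x + \<epsilon>"
          by (rule minimax_approx[of safe_actions x \<epsilon> vsafe, OF safe_actions_nonempty \<open>0 < \<epsilon>\<close>])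
            (simp add: eq)
        define c' where "c' a = (if a \<in> safe_actions x then c a else m x a)" for a
        show "minimax (\<lambda>_. UNIV) U x \<le> vmin x - \<eta> + \<epsilon>"
        proof (rule minimax_le[of _ _ c'])
          show "c' \<in> choices I x"
            using c(1) m(1) by (simp add: c'_def choices_def)
          fix a
          show "av (c' a) U \<le> vmin x - \<eta> + \<epsilon>"
          proof (cases "a \<in> safe_actions x")
            case a: True
            have "av (c a) U \<le> av (c a) (\<lambda>x. vsafe x + (d - \<eta>))" by (intro av_mono U_le')
            also have "\<dots> = av (c a) vsafe + (d - \<eta>)" by (simp add: av_add)
            also have "\<dots> \<le> vmin x - \<eta> + \<epsilon>" using c(2)[OF a] True by (simp add: D_def)
            finally show ?thesis using a by (simp add: c'_def)
          next
            case a: False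
            have "av (m x a) U \<le> av (m x a) vmin" by (intro av_mono U_le)
            also have "\<dots> \<le> vmin x - \<eta>" by (rule \<eta>_unsafe[OF True a])
            finally show ?thesis using a \<open>0 < \<epsilon>\<close> by (simp add: c'_def)
          qed
        qed simp
      qed
      then show ?thesis using True D_FG[OF True] by (simp add: U_def min_op_def guarded_def)
    qed
  qed
  then show False using y \<open>0 < \<eta>\<close> by (simp add: U_def)
qed

lemma vsafe_eq_vmin: "vsafe = vmin"
proof (rule ext, rule antisym)
  fix s
  show "vsafe s \<le> vmin s"
  proof (rule fixval_least[OF ne_safe fixval_nonneg[OF ne_min]])
    fix s
    have "min_op safe_actions vmin s \<le> min_op (\<lambda>_. UNIV) vmin s"
      using minimax_shift[of safe_actions s "\<lambda>_. UNIV" vmin vmin 0] safe_actions_nonempty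
      by (simp add: min_op_def guarded_def)
    then show "min_op safe_actions vmin s \<le> vmin s"
      by (simp add: fixval_fixpoint[OF ne_min])
  qed
qed (rule vmin_le_vsafe)

text \<open>The scheduler plays safe actions only, which never lowers the expected value of \<open>vmin\<close>,
  and in rounds of length \<open>N\<close> it maximises the probability of reaching the target before
  the end of the current round.\<close>

definition greedy :: "nat \<Rightarrow> nat \<Rightarrow> ('s list \<Rightarrow> 'a \<Rightarrow> 's pmf) \<Rightarrow> 's list \<Rightarrow> 'a" where
  "greedy N i \<pi> w = (SOME a. a \<in> safe_actions (last w) \<and>
     (let U = approx (min_op safe_actions) (N - 1 - (i + length w - 1) mod N)
      in \<forall>b\<in>safe_actions (last w). av (\<pi> w b) U \<le> av (\<pi> w a) U))"

lemma greedy_first: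
  assumes "is_nature I \<pi>"
  shows "greedy N i \<pi> [s] \<in> safe_actions s"
    and "minimax safe_actions (approx (min_op safe_actions) (N - 1 - i mod N)) s
      \<le> av (\<pi> [s] (greedy N i \<pi> [s])) (approx (min_op safe_actions) (N - 1 - i mod N))"
proof -
  let ?U = "approx (min_op safe_actions) (N - 1 - i mod N)"
  let ?P = "\<lambda>a. a \<in> safe_actions s \<and> (\<forall>b\<in>safe_actions s. av (\<pi> [s] b) ?U \<le> av (\<pi> [s] a) ?U)"
  have "\<exists>a. ?P a"
    by (rule minimax_attained[of safe_actions s "\<pi> [s]" ?U, OF safe_actions_nonempty nature_choices[OF assms]])
      blast
  then have "?P (SOME a. ?P a)" by (rule someI_ex)
  moreover have "greedy N i \<pi> [s] = (SOME a. ?P a)"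
    by (simp add: greedy_def Let_def)
  ultimately have P: "?P (greedy N i \<pi> [s])" by simp
  then show "greedy N i \<pi> [s] \<in> safe_actions s" by blast
  show "minimax safe_actions ?U s \<le> av (\<pi> [s] (greedy N i \<pi> [s])) ?U"
    by (rule minimax_le[of safe_actions s "\<pi> [s]" ?U, OF safe_actions_nonempty nature_choices[OF assms]])
      (use P in blast)
qed

text \<open>The offset \<open>i\<close> keeps the round clock running when the first state is
  dropped from the history.\<close>

lemma greedy_after: "greedy N i \<pi> (s # y # v) = greedy N (Suc i) (after s \<pi>) (y # v)"
  by (simp add: greedy_def after_def)

lemma greedy_unfold:
  assumes "s \<in> F" "s \<notin> G"
  shows "reach F G (\<lambda>w. return_pmf (greedy N i \<pi> w)) \<pi> s
    = av (\<pi> [s] (greedy N i \<pi> [s])) (reach F G (\<lambda>w. return_pmf (greedy N (Suc i) (after s \<pi>) w)) (after s \<pi>))"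
proof -
  have "reach F G (after s (\<lambda>w. return_pmf (greedy N i \<pi> w))) (after s \<pi>)
      = reach F G (\<lambda>w. return_pmf (greedy N (Suc i) (after s \<pi>) w)) (after s \<pi>)"
    by (rule ext, rule reach_cong) (simp_all add: after_def[of s "\<lambda>w. return_pmf (greedy N i \<pi> w)"] greedy_after)
  then show ?thesis
    using assms by (subst reach_unfold) simp
qed

text \<open>With \<open>Suc j\<close> moves left in the round, including the present one, the greedy
  rule looks \<open>j\<close> steps beyond this move. At a round boundary \<open>i mod N\<close> is
  0 and \<open>j\<close> is \<open>N - 1\<close>.\<close>

lemma round_position:
  fixes i j N :: nat
  assumes "Suc j \<le> N" "N dvd i + Suc j"
  shows "N - 1 - i mod N = j"
proof -
  have "0 < N" using assms by simp
  have "N dvd i mod N + Suc j"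
    using assms(2) by (metis dvd_eq_mod_eq_0 mod_add_left_eq)
  then obtain k where k: "i mod N + Suc j = N * k" by (auto elim: dvdE)
  have "i mod N < N" using \<open>0 < N\<close> by simp
  have "k = 1"
  proof -
    have "N * k < N * 2" using k \<open>i mod N < N\<close> assms(1) by linarith
    then have "k < 2" by simp
    moreover have "k \<noteq> 0" using k by (intro notI) simp
    ultimately show ?thesis by simp
  qed
  with k show ?thesis by simp
qed

text \<open>A shortfall of at most \<open>l\<close> at round starts is scaled down during a round by
  the approximate chance of missing the target. Safe actions preserve the expected
  \<open>vmin\<close>, the greedy one also supports the next iterate of \<open>approx\<close>, and a
  play that has hit the target has no shortfall.\<close>

lemma greedy_round:
  assumes bound: "\<And>\<pi> i s. is_nature I \<pi> \<Longrightarrow> N dvd i \<Longrightarrow>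
      vmin s - l \<le> reach F G (\<lambda>w. return_pmf (greedy N i \<pi> w)) \<pi> s"
    and "0 \<le> l" "j \<le> N" "N dvd i + j" "is_nature I \<pi>"
  shows "vmin s - l * (1 - approx (min_op safe_actions) j s) \<le> reach F G (\<lambda>w. return_pmf (greedy N i \<pi> w)) \<pi> s"
  using assms(3-5)
proof (induction j arbitrary: i \<pi> s)
  case 0
  then show ?case using bound by simp
next
  case (Suc j)
  let ?A = "approx (min_op safe_actions)"
  let ?r = "\<lambda>i \<pi>. reach F G (\<lambda>w. return_pmf (greedy N i \<pi> w)) \<pi>"
  let ?\<pi> = "after s \<pi>"
  show ?case
  proof (cases "s \<in> F \<and> s \<notin> G")
    case True
    let ?a = "greedy N i \<pi> [s]"
    have pos: "N - 1 - i mod N = j"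
      using Suc.prems by (intro round_position) auto
    have "vmin s \<le> av (\<pi> [s] ?a) vmin"
      using greedy_first(1)[OF Suc.prems(3), of N i s] nature_choices[OF Suc.prems(3), of s] True
      by (simp add: safe_actions_def choices_def)
    moreover have "?A (Suc j) s \<le> av (\<pi> [s] ?a) (?A j)"
      using greedy_first(2)[OF Suc.prems(3), of N i s] True
      unfolding pos by (simp add: approx_Suc min_op_def guarded_def)
    then have "l * ?A (Suc j) s \<le> l * av (\<pi> [s] ?a) (?A j)"
      using \<open>0 \<le> l\<close> by (rule mult_left_mono)
    ultimately have "vmin s - l * (1 - ?A (Suc j) s) \<le> av (\<pi> [s] ?a) vmin - l * (1 - av (\<pi> [s] ?a) (?A j))"
      by (simp add: algebra_simps)
    also have "\<dots> = av (\<pi> [s] ?a) (\<lambda>x. vmin x - l * (1 - ?A j x))"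
      by (simp add: av_diff av_cmult)
    also have "\<dots> \<le> av (\<pi> [s] ?a) (?r (Suc i) ?\<pi>)"
      using Suc.prems is_nature_after[OF Suc.prems(3)] by (intro av_mono Suc.IH) auto
    also have "\<dots> = ?r i \<pi> s"
      using True by (simp add: greedy_unfold)
    finally show ?thesis .
  next
    case False
    have "?A (Suc j) s \<le> 1" by (rule approx_le_1[OF ne_safe])
    then have "0 \<le> l * (1 - ?A (Suc j) s)" using \<open>0 \<le> l\<close> by simp
    moreover have "vmin s = ?r i \<pi> s"
      using False by (subst reach_unfold, subst vmin_unfold) (auto simp: guarded_def)
    ultimately show ?thesis by linarith
  qed
qed

text \<open>Each round multiplies the shortfall by a fixed factor \<open>q < 1\<close>, so it
  vanishes in the limit. States of value 0 need no argument.\<close>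

lemma ex_scheduler_ge_vmin:
  assumes "is_nature I \<pi>"
  obtains \<sigma> where "vmin s \<le> reach F G \<sigma> \<pi> s"
proof -
  have "\<exists>\<beta>>0. \<beta> \<le> 1 \<and> (\<forall>z\<in>vmin ` {s. 0 < vmin s}. \<beta> \<le> z)"
    by (rule finite_pos_lower_bound) auto
  then obtain \<beta> where \<beta>: "0 < \<beta>" "\<beta> \<le> 1" "\<And>s. 0 < vmin s \<Longrightarrow> \<beta> \<le> vmin s"
    by auto
  \<comment> \<open>As \<open>\<beta>\<close> is at most every positive value, \<open>N\<close>
    steps yield at least \<open>\<beta> / 2\<close> from each state of positive value; hence
    \<open>q = 1 - \<beta> / 2\<close>.\<close>
  obtain N where N: "\<And>s. vmin s - \<beta> / 2 \<le> approx (min_op safe_actions) N s"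
    by (rule approx_uniform[OF ne_safe, of "\<beta> / 2", unfolded vsafe_eq_vmin])
      (use \<beta>(1) in simp, rule that)
  let ?r = "\<lambda>i \<pi>. reach F G (\<lambda>w. return_pmf (greedy N i \<pi> w)) \<pi>"
  define q where "q = 1 - \<beta> / 2"
  have q: "0 \<le> q" "q < 1" using \<beta> by (simp_all add: q_def)
  have "is_nature I \<pi> \<Longrightarrow> N dvd i \<Longrightarrow> vmin s - q ^ k \<le> ?r i \<pi> s" for k \<pi> i s
  proof (induction k arbitrary: \<pi> i s)
    case 0
    show ?case using fixval_le_1[OF ne_min, of s] reach_nonneg[of F G "\<lambda>w. return_pmf (greedy N i \<pi> w)" \<pi> s]
      by simp
  next
    case (Suc k)
    show ?case
    proof (cases "0 < vmin s")
      case True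
      have "1 - approx (min_op safe_actions) N s \<le> q"
        using N[of s] \<beta>(3)[of s] True by (simp add: q_def field_simps)
      then have "q ^ k * (1 - approx (min_op safe_actions) N s) \<le> q ^ k * q"
        using q by (intro mult_left_mono) auto
      moreover have "vmin s - q ^ k * (1 - approx (min_op safe_actions) N s) \<le> ?r i \<pi> s"
        using Suc q by (intro greedy_round) auto
      ultimately show ?thesis by (simp add: mult.commute)
    next
      case False
      moreover have "0 \<le> q ^ Suc k" using q by (intro zero_le_power)
      ultimately have "vmin s - q ^ Suc k \<le> 0" by linarith
      also have "\<dots> \<le> ?r i \<pi> s" by (rule reach_nonneg)
      finally show ?thesis .
    qed
  qed
  from this[OF assms, of 0] have "vmin s - q ^ k \<le> ?r 0 \<pi> s" for k by simp
  moreover have "(\<lambda>k. vmin s - q ^ k) \<longlonglongrightarrow> vmin s - 0"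
    using q by (intro tendsto_diff tendsto_const LIMSEQ_power_zero) auto
  ultimately have "vmin s - 0 \<le> ?r 0 \<pi> s"
    by (intro LIMSEQ_le_const2) auto
  then show ?thesis using that by simp
qed

lemma vmin_less_iff:
  "(\<exists>\<pi>. is_nature I \<pi> \<and> (\<forall>\<sigma>. reach F G \<sigma> \<pi> s < p)) \<longleftrightarrow> vmin s < p"
proof
  assume "\<exists>\<pi>. is_nature I \<pi> \<and> (\<forall>\<sigma>. reach F G \<sigma> \<pi> s < p)"
  then obtain \<pi> where "is_nature I \<pi>" and less: "\<And>\<sigma>. reach F G \<sigma> \<pi> s < p" by blast
  from this(1) obtain \<sigma> where "vmin s \<le> reach F G \<sigma> \<pi> s" by (rule ex_scheduler_ge_vmin)
  with less[of \<sigma>] show "vmin s < p" by simp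
next
  assume "vmin s < p"
  then have "0 < (p - vmin s) / 2" by simp
  then obtain \<pi> where \<pi>: "is_nature I \<pi>" "\<And>\<sigma> s'. reach F G \<sigma> \<pi> s' \<le> vmin s' + (p - vmin s) / 2"
    using min_near_optimal by blast
  have "reach F G \<sigma> \<pi> s < p" for \<sigma>
    using \<pi>(2)[of \<sigma> s] \<open>vmin s < p\<close> by (simp add: field_simps)
  with \<pi>(1) show "\<exists>\<pi>. is_nature I \<pi> \<and> (\<forall>\<sigma>. reach F G \<sigma> \<pi> s < p)" by blast
qed

section \<open>Replies to a maximising nature and its near-optimal play\<close>

lemma vmax_ge_choice:
  assumes "s \<in> F" "s \<notin> G" "c \<in> choices I s"
  shows "\<exists>a. av (c a) vmax \<le> vmax s"
proof -
  have eq: "minimax (\<lambda>_. UNIV) (\<lambda>x. - vmax x) s = - vmax s"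
    using vmax_unfold[of s] assms by (simp add: guarded_def)
  show ?thesis
    by (rule minimax_attained[of "\<lambda>_. UNIV" s c "\<lambda>x. - vmax x"])
      (use assms in \<open>auto simp add: eq av_minus\<close>)
qed

text \<open>The scheduler only has to keep the expected \<open>vmax\<close> from rising; the bound
  at all finite horizons then passes to the limit without any concern for progress.\<close>

lemma ex_scheduler_le_vmax:
  assumes "is_nature I \<pi>"
  obtains \<sigma> where "reach F G \<sigma> \<pi> s \<le> vmax s"
proof -
  define g where "g \<pi> w = return_pmf (SOME a. av (\<pi> w a) vmax \<le> vmax (last w))" for \<pi> :: "'s list \<Rightarrow> 'a \<Rightarrow> 's pmf" and w
  have "is_nature I \<pi> \<Longrightarrow> uval F G n (g \<pi>) \<pi> s \<le> vmax s" for n \<pi> s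
  proof (induction n arbitrary: \<pi> s)
    case 0
    show ?case using fixval_nonneg[OF nonexp_max_op] by simp
  next
    case (Suc n)
    show ?case
    proof (cases "s \<in> F \<and> s \<notin> G")
      case True
      let ?a = "SOME a. av (\<pi> [s] a) vmax \<le> vmax s"
      have "uval F G n (after s (g \<pi>)) (after s \<pi>) x = uval F G n (g (after s \<pi>)) (after s \<pi>) x" for x
        unfolding uval_def by (rule val_cong) (simp_all add: after_def g_def)
      then have "uval F G n (after s (g \<pi>)) (after s \<pi>) x \<le> vmax x" for x
        using Suc.IH[OF is_nature_after[OF Suc.prems]] by simp
      then have "av (\<pi> [s] ?a) (uval F G n (after s (g \<pi>)) (after s \<pi>)) \<le> av (\<pi> [s] ?a) vmax"
        by (intro av_mono)
      also have "\<dots> \<le> vmax s"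
        using vmax_ge_choice[of s, OF _ _ nature_choices[OF Suc.prems]] True
        by (intro someI_ex[of "\<lambda>a. av (\<pi> [s] a) vmax \<le> vmax s"]) blast
      finally have le: "av (\<pi> [s] ?a) (uval F G n (after s (g \<pi>)) (after s \<pi>)) \<le> vmax s" .
      have "g \<pi> [s] = return_pmf ?a" by (simp add: g_def)
      then have "av (\<pi> [s] ?a) (uval F G n (after s (g \<pi>)) (after s \<pi>)) = uval F G (Suc n) (g \<pi>) \<pi> s"
        using True by (simp add: uval_Suc)
      with le show ?thesis by simp
    next
      case False
      then show ?thesis using vmax_unfold[of s] by (auto simp: uval_Suc guarded_def)
    qed
  qed
  from this[OF assms] have "reach F G (g \<pi>) \<pi> s \<le> vmax s" by (rule reach_le)
  then show ?thesis by (rule that)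
qed

text \<open>Lower bounds at a finite horizon already bound the unbounded probability. Nature
  therefore plays for a horizon \<open>N\<close> that loses at most \<open>\<epsilon> / 2\<close>,
  and spreads another \<open>\<epsilon> / 2\<close> over its moves.\<close>

lemma max_near_optimal:
  assumes "0 < \<epsilon>"
  obtains \<pi> where "is_nature I \<pi>" "\<And>\<sigma> s. vmax s - \<epsilon> \<le> reach F G \<sigma> \<pi> s"
proof -
  obtain N where N: "\<And>s. vmax s - \<epsilon> / 2 \<le> approx max_op N s"
    using approx_uniform[OF nonexp_max_op, of "\<epsilon> / 2"] assms by auto
  define \<delta> where "\<delta> = \<epsilon> / 2 / real (Suc N)"
  have \<delta>: "0 < \<delta>" "real N * \<delta> \<le> \<epsilon> / 2"
    using assms by (simp_all add: \<delta>_def field_simps)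
  have "\<exists>c. c \<in> choices I s \<and> (s \<in> F \<longrightarrow> s \<notin> G \<longrightarrow> (\<forall>a. approx max_op (Suc j) s - \<delta> \<le> av (c a) (approx max_op j)))" for j s
  proof (rule minimax_approx[of "\<lambda>_. UNIV" s \<delta> "\<lambda>x. - approx max_op j x"])
    fix c
    assume c: "c \<in> choices I s"
      "\<And>a. a \<in> UNIV \<Longrightarrow> av (c a) (\<lambda>x. - approx max_op j x) \<le> minimax (\<lambda>_. UNIV) (\<lambda>x. - approx max_op j x) s + \<delta>"
    have "approx max_op (Suc j) s - \<delta> \<le> av (c a) (approx max_op j)" if "s \<in> F" "s \<notin> G" for a
      using c(2)[of a] that by (simp add: approx_Suc max_op_def guarded_def av_minus)
    with c(1) show ?thesis by blast
  qed (use \<delta> in simp_all)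
  from choice2[of "\<lambda>j s c. c \<in> choices I s \<and> (s \<in> F \<longrightarrow> s \<notin> G \<longrightarrow> (\<forall>a. approx max_op (Suc j) s - \<delta> \<le> av (c a) (approx max_op j)))", OF this]
  obtain c where c: "\<And>j s. c j s \<in> choices I s"
    "\<And>j s a. s \<in> F \<Longrightarrow> s \<notin> G \<Longrightarrow> approx max_op (Suc j) s - \<delta> \<le> av (c j s a) (approx max_op j)"
    by blast
  \<comment> \<open>A countdown: the first move uses level \<open>j - 1\<close>. Past the horizon,
    truncated subtraction leaves level 0, an arbitrary legal choice.\<close>
  define p where "p j w = c (j - length w) (last w)" for j and w :: "'s list"
  have "approx max_op j s - real j * \<delta> \<le> uval F G j \<sigma> (p j) s" for j \<sigma> s
  proof (induction j arbitrary: \<sigma> s)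
    case (Suc j)
    show ?case
    proof (cases "s \<in> F \<and> s \<notin> G")
      case True
      have "approx max_op (Suc j) s - real (Suc j) * \<delta> \<le> av (p (Suc j) [s] a) (uval F G j (after s \<sigma>) (after s (p (Suc j))))" for a
      proof -
        have "uval F G j (after s \<sigma>) (after s (p (Suc j))) x = uval F G j (after s \<sigma>) (p j) x" for x
          unfolding uval_def by (rule val_cong) (simp_all add: after_def p_def)
        then have "approx max_op j x - real j * \<delta> \<le> uval F G j (after s \<sigma>) (after s (p (Suc j))) x" for x
          using Suc.IH by simp
        then have "av (c j s a) (\<lambda>x. approx max_op j x - real j * \<delta>)
            \<le> av (c j s a) (uval F G j (after s \<sigma>) (after s (p (Suc j))))" by (intro av_mono)
        moreover have "approx max_op (Suc j) s - \<delta> \<le> av (c j s a) (approx max_op j)"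
          using c(2) True by blast
        ultimately show ?thesis by (simp add: p_def av_diff algebra_simps)
      qed
      then show ?thesis using True by (auto simp: uval_Suc intro: av_ge)
    next
      case False
      then show ?thesis using \<delta>(1) by (auto simp: uval_Suc approx_Suc max_op_def guarded_def)
    qed
  qed simp
  then have "vmax s - \<epsilon> \<le> reach F G \<sigma> (p N) s" for \<sigma> s
    using N[of s] \<delta>(2) uval_le_reach[of F G N \<sigma> "p N" s] by (smt (verit) field_sum_of_halves)
  moreover have "is_nature I (p N)"
    using c(1) by (simp add: is_nature_def p_def choices_def)
  ultimately show ?thesis using that by blast
qed

lemma vmax_greater_iff:
  "(\<exists>\<pi>. is_nature I \<pi> \<and> (\<forall>\<sigma>. reach F G \<sigma> \<pi> s > p)) \<longleftrightarrow> vmax s > p"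
proof
  assume "\<exists>\<pi>. is_nature I \<pi> \<and> (\<forall>\<sigma>. reach F G \<sigma> \<pi> s > p)"
  then obtain \<pi> where "is_nature I \<pi>" and less: "\<And>\<sigma>. reach F G \<sigma> \<pi> s > p" by blast
  from this(1) obtain \<sigma> where "reach F G \<sigma> \<pi> s \<le> vmax s" by (rule ex_scheduler_le_vmax)
  with less[of \<sigma>] show "vmax s > p" by simp
next
  assume "vmax s > p"
  then have "0 < (vmax s - p) / 2" by simp
  then obtain \<pi> where \<pi>: "is_nature I \<pi>" "\<And>\<sigma> s'. vmax s' - (vmax s - p) / 2 \<le> reach F G \<sigma> \<pi> s'"
    using max_near_optimal by blast
  have "reach F G \<sigma> \<pi> s > p" for \<sigma>
    using \<pi>(2)[of s \<sigma>] \<open>vmax s > p\<close> by (simp add: field_simps)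
  with \<pi>(1) show "\<exists>\<pi>. is_nature I \<pi> \<and> (\<forall>\<sigma>. reach F G \<sigma> \<pi> s > p)" by blast
qed

end

section \<open>Optimal minimising natures\<close>

text \<open>Plays \<open>c\<close> memorylessly while the path stays in \<open>X\<close> and hands
  over to \<open>\<pi>\<close> for good at the first state outside. From then on
  \<open>\<pi>\<close> sees the history that begins at this exit state.\<close>

fun switch :: "'s set \<Rightarrow> ('s \<Rightarrow> 'b) \<Rightarrow> ('s list \<Rightarrow> 'b) \<Rightarrow> 's list \<Rightarrow> 'b" where
  "switch X c \<pi> [] = \<pi> []"
| "switch X c \<pi> [x] = (if x \<in> X then c x else \<pi> [x])"
| "switch X c \<pi> (x # y # v) = (if x \<in> X then switch X c \<pi> (y # v) else \<pi> (x # y # v))"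

lemma switch_outside: "x \<notin> X \<Longrightarrow> switch X c \<pi> (x # v) = \<pi> (x # v)"
  by (cases v) simp_all

lemma after_switch: "x \<in> X \<Longrightarrow> after x (switch X c \<pi>) (y # v) = switch X c \<pi> (y # v)"
  by (simp add: after_def)

lemma is_nature_switch:
  assumes "\<And>x. x \<in> X \<Longrightarrow> c x \<in> choices I x" "is_nature I \<pi>"
  shows "is_nature I (switch X c \<pi>)"
  unfolding is_nature_def
proof (intro allI impI)
  fix w :: "'a list" and a :: 'b
  have \<pi>: "\<pi> w a \<in> Gamma I (last w) a" if "w \<noteq> []" for w
    using assms(2) that unfolding is_nature_def by blast
  assume "w \<noteq> []"
  then show "switch X c \<pi> w a \<in> Gamma I (last w) a"
  proof (induction w rule: induct_list012)
    case (2 x)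
    then show ?case using assms(1) \<pi>[of "[x]"] by (auto simp: choices_def)
  next
    case (3 x y v)
    then show ?case using \<pi>[of "x # y # v"] by simp
  qed simp
qed

context until_game begin

text \<open>The scheduler can secure \<open>vmin\<close> from every successor, so the first move
  cannot raise the expected value. If an action is tight, there is no room left for exceeding
  \<open>vmin\<close> at any reached successor: the rest of the nature is optimal there.\<close>

lemma min_witness_step:
  assumes \<pi>: "is_nature I \<pi>" and opt: "\<And>\<sigma>. reach F G \<sigma> \<pi> s \<le> vmin s" and s: "s \<in> F" "s \<notin> G"
  shows "av (\<pi> [s] a) vmin \<le> vmin s"
    and "av (\<pi> [s] a) vmin = vmin s \<Longrightarrow> x \<in> set_pmf (\<pi> [s] a) \<Longrightarrow> reach F G \<sigma> (after s \<pi>) x \<le> vmin x"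
proof -
  have "\<forall>x. \<exists>\<sigma>. vmin x \<le> reach F G \<sigma> (after s \<pi>) x"
    using ex_scheduler_ge_vmin[OF is_nature_after[OF \<pi>]] by blast
  from choice[OF this] obtain k where k: "\<And>x. vmin x \<le> reach F G (k x) (after s \<pi>) x" by blast
  have le: "av (\<pi> [s] a) (\<lambda>x. reach F G (k x) (after s \<pi>) x) \<le> vmin s" for k
    using opt[of "glue (\<lambda>_. return_pmf a) k"] s by (subst (asm) reach_unfold) simp
  show "av (\<pi> [s] a) vmin \<le> vmin s"
    by (rule order_trans[OF av_mono[OF k] le])
  assume tight: "av (\<pi> [s] a) vmin = vmin s" and x: "x \<in> set_pmf (\<pi> [s] a)"
  show "reach F G \<sigma> (after s \<pi>) x \<le> vmin x"
  proof (rule ccontr)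
    assume contra: "\<not> ?thesis"
    \<comment> \<open>The better reply is used at \<open>x\<close> only; as \<open>x\<close> has
      positive probability, the average increases strictly.\<close>
    let ?k = "k(x := \<sigma>)"
    have "av (\<pi> [s] a) vmin < av (\<pi> [s] a) (\<lambda>y. reach F G (?k y) (after s \<pi>) y)"
      by (rule av_strict_mono[OF _ x]) (use k contra in auto)
    with le[of ?k] tight show False by simp
  qed
qed

lemma max_witness_step:
  assumes \<pi>: "is_nature I \<pi>" and opt: "\<And>\<sigma>. vmax s \<le> reach F G \<sigma> \<pi> s" and s: "s \<in> F" "s \<notin> G"
  shows "vmax s \<le> av (\<pi> [s] a) vmax"
    and "av (\<pi> [s] a) vmax = vmax s \<Longrightarrow> x \<in> set_pmf (\<pi> [s] a) \<Longrightarrow> vmax x \<le> reach F G \<sigma> (after s \<pi>) x"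
proof -
  have "\<forall>x. \<exists>\<sigma>. reach F G \<sigma> (after s \<pi>) x \<le> vmax x"
    using ex_scheduler_le_vmax[OF is_nature_after[OF \<pi>]] by blast
  from choice[OF this] obtain k where k: "\<And>x. reach F G (k x) (after s \<pi>) x \<le> vmax x" by blast
  have ge: "vmax s \<le> av (\<pi> [s] a) (\<lambda>x. reach F G (k x) (after s \<pi>) x)" for k
    using opt[of "glue (\<lambda>_. return_pmf a) k"] s by (subst (asm) reach_unfold) simp
  show "vmax s \<le> av (\<pi> [s] a) vmax"
    by (rule order_trans[OF ge av_mono[OF k]])
  assume tight: "av (\<pi> [s] a) vmax = vmax s" and x: "x \<in> set_pmf (\<pi> [s] a)"
  show "vmax x \<le> reach F G \<sigma> (after s \<pi>) x"
  proof (rule ccontr)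
    assume contra: "\<not> ?thesis"
    let ?k = "k(x := \<sigma>)"
    have "av (\<pi> [s] a) (\<lambda>y. reach F G (?k y) (after s \<pi>) y) < av (\<pi> [s] a) vmax"
      by (rule av_strict_mono[OF _ x]) (use k contra in auto)
    with ge[of ?k] tight show False by simp
  qed
qed

definition min_opt :: "'s set" where
  "min_opt = {s. \<exists>\<pi>. is_nature I \<pi> \<and> (\<forall>\<sigma>. reach F G \<sigma> \<pi> s \<le> vmin s)}"

definition max_opt :: "'s set" where
  "max_opt = {s. \<exists>\<pi>. is_nature I \<pi> \<and> (\<forall>\<sigma>. vmax s \<le> reach F G \<sigma> \<pi> s)}"

lemma vmin_le_iff:
  "(\<exists>\<pi>. is_nature I \<pi> \<and> (\<forall>\<sigma>. reach F G \<sigma> \<pi> s \<le> p)) \<longleftrightarrow> vmin s < p \<or> vmin s = p \<and> s \<in> min_opt"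
proof
  assume "\<exists>\<pi>. is_nature I \<pi> \<and> (\<forall>\<sigma>. reach F G \<sigma> \<pi> s \<le> p)"
  then obtain \<pi> where \<pi>: "is_nature I \<pi>" and le: "\<And>\<sigma>. reach F G \<sigma> \<pi> s \<le> p" by blast
  obtain \<sigma> where "vmin s \<le> reach F G \<sigma> \<pi> s" by (rule ex_scheduler_ge_vmin[OF \<pi>])
  with le[of \<sigma>] have "vmin s \<le> p" by simp
  then show "vmin s < p \<or> vmin s = p \<and> s \<in> min_opt"
    using \<pi> le by (auto simp: min_opt_def)
next
  assume "vmin s < p \<or> vmin s = p \<and> s \<in> min_opt"
  then show "\<exists>\<pi>. is_nature I \<pi> \<and> (\<forall>\<sigma>. reach F G \<sigma> \<pi> s \<le> p)"
    using vmin_less_iff[of s p] by (auto simp: min_opt_def intro: less_imp_le)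
qed

lemma vmax_ge_iff:
  "(\<exists>\<pi>. is_nature I \<pi> \<and> (\<forall>\<sigma>. reach F G \<sigma> \<pi> s \<ge> p)) \<longleftrightarrow> vmax s > p \<or> vmax s = p \<and> s \<in> max_opt"
proof
  assume "\<exists>\<pi>. is_nature I \<pi> \<and> (\<forall>\<sigma>. reach F G \<sigma> \<pi> s \<ge> p)"
  then obtain \<pi> where \<pi>: "is_nature I \<pi>" and ge: "\<And>\<sigma>. reach F G \<sigma> \<pi> s \<ge> p" by blast
  obtain \<sigma> where "reach F G \<sigma> \<pi> s \<le> vmax s" by (rule ex_scheduler_le_vmax[OF \<pi>])
  with ge[of \<sigma>] have "vmax s \<ge> p" by simp
  then show "vmax s > p \<or> vmax s = p \<and> s \<in> max_opt"
    using \<pi> ge by (auto simp: max_opt_def)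
next
  assume "vmax s > p \<or> vmax s = p \<and> s \<in> max_opt"
  then show "\<exists>\<pi>. is_nature I \<pi> \<and> (\<forall>\<sigma>. reach F G \<sigma> \<pi> s \<ge> p)"
    using vmax_greater_iff[of p s] by (auto simp: max_opt_def intro: less_imp_le)
qed

end

section \<open>Invariance of values and of minimising optima\<close>

locale until_bisim = until_game I F G
  for I :: "'s::finite \<Rightarrow> 'a::finite \<Rightarrow> 's \<Rightarrow> real set" and F G +
  fixes L :: "'s \<Rightarrow> 'ap set" and R :: "('s \<times> 's) set"
  assumes bisim: "is_bisim L I R"
    and FG_inv: "\<And>x y. (x, y) \<in> R \<Longrightarrow> (x \<in> F \<longleftrightarrow> y \<in> F) \<and> (x \<in> G \<longleftrightarrow> y \<in> G)"
begin

lemma equiv_R: "equiv UNIV R"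
  using bisim by (simp add: is_bisim_def)

lemma R_sym: "(x, y) \<in> R \<Longrightarrow> (y, x) \<in> R"
  using equiv_R by (auto simp: equiv_def sym_def)

lemma R_refl: "(x, x) \<in> R"
  using equiv_R by (auto simp: equiv_def refl_on_def)

lemma R_trans: "(x, y) \<in> R \<Longrightarrow> (y, z) \<in> R \<Longrightarrow> (x, z) \<in> R"
  using equiv_R by (auto simp: equiv_def dest: transD)

definition matches :: "('a \<Rightarrow> 's pmf) \<Rightarrow> 's pmf \<Rightarrow> 'a pmf \<Rightarrow> bool" where
  "matches c \<nu> \<rho> \<longleftrightarrow> (\<forall>U. (\<forall>x y. (x, y) \<in> R \<longrightarrow> U x = U y) \<longrightarrow> av \<nu> U = av \<rho> (\<lambda>b. av (c b) U))"

lemma matchesD: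
  assumes "matches c \<nu> \<rho>" "\<And>x y. (x, y) \<in> R \<Longrightarrow> U x = U y"
  shows "av \<nu> U = av \<rho> (\<lambda>b. av (c b) U)"
  using assms unfolding matches_def by blast

lemma choice_match:
  assumes "(s, t) \<in> R" "c \<in> choices I s"
  shows "\<exists>d\<in>choices I t. \<forall>a. \<exists>\<rho>. matches c (d a) \<rho>"
proof (rule bisim_choice_match[OF bisim assms])
  fix d
  assume "d \<in> choices I t"
    "\<And>a. \<exists>\<rho>. \<forall>U. (\<forall>x y. (x, y) \<in> R \<longrightarrow> U x = U y) \<longrightarrow> av (d a) U = av \<rho> (\<lambda>b. av (c b) U)"
  then show ?thesis unfolding matches_def by (intro bexI allI)
qed

text \<open>A class is hit with positive probability iff its indicator has positive mean, and
  indicators of classes are invariant. So a matched distribution and its mixture hit the same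
  classes.\<close>

lemma matches_class:
  assumes "matches c \<nu> \<rho>"
  shows "(\<exists>x\<in>set_pmf \<nu>. (z, x) \<in> R) \<longleftrightarrow> (\<exists>b\<in>set_pmf \<rho>. \<exists>y\<in>set_pmf (c b). (z, y) \<in> R)"
proof -
  let ?U = "indicator (R `` {z}) :: 's \<Rightarrow> real"
  have eq: "av \<nu> ?U = av \<rho> (\<lambda>b. av (c b) ?U)"
  proof (rule matchesD[OF assms])
    show "?U x = ?U y" if "(x, y) \<in> R" for x y
    proof -
      have "(z, x) \<in> R \<longleftrightarrow> (z, y) \<in> R"
        using R_trans[of z x y] R_trans[of z y x] R_sym[OF that] that by blast
      then show ?thesis by (simp add: indicator_def)
    qed
  qed
  have pos: "0 < av p ?U \<longleftrightarrow> (\<exists>x\<in>set_pmf p. (z, x) \<in> R)" for p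
    by (subst av_pos_iff) (auto simp: indicator_def split: if_splits)
  have "0 < av \<rho> (\<lambda>b. av (c b) ?U) \<longleftrightarrow> (\<exists>b\<in>set_pmf \<rho>. 0 < av (c b) ?U)"
    by (rule av_pos_iff) (auto intro: av_ge)
  then show ?thesis
    unfolding pos eq[symmetric] .
qed

lemma minimax_inv:
  assumes U: "\<And>x y. (x, y) \<in> R \<Longrightarrow> U x = U y" and st: "(s, t) \<in> R"
  shows "minimax (\<lambda>_. UNIV) U s = minimax (\<lambda>_. UNIV) U t"
proof -
  have "minimax (\<lambda>_. UNIV) U t \<le> minimax (\<lambda>_. UNIV) U s" if "(s, t) \<in> R" for s t
  proof (rule field_le_epsilon)
    fix \<epsilon> :: real assume "0 < \<epsilon>"
    show "minimax (\<lambda>_. UNIV) U t \<le> minimax (\<lambda>_. UNIV) U s + \<epsilon>"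
    proof (rule minimax_approx[of "\<lambda>_. UNIV" s \<epsilon> U])
      fix c
      assume c: "c \<in> choices I s" "\<And>a. a \<in> UNIV \<Longrightarrow> av (c a) U \<le> minimax (\<lambda>_. UNIV) U s + \<epsilon>"
      obtain d where d: "d \<in> choices I t" "\<forall>a. \<exists>\<rho>. matches c (d a) \<rho>"
        using choice_match[OF \<open>(s, t) \<in> R\<close> c(1)] by blast
      show ?thesis
      proof (rule minimax_le[of "\<lambda>_. UNIV" t d U])
        fix a
        obtain \<rho> where "matches c (d a) \<rho>" using d(2) by blast
        from matchesD[OF this U] show "av (d a) U \<le> minimax (\<lambda>_. UNIV) U s + \<epsilon>"
          using c(2) by (auto intro: av_le)
      qed (use d in simp_all)
    qed (use \<open>0 < \<epsilon>\<close> in simp_all)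
  qed
  from this[OF st] this[OF R_sym[OF st]] show ?thesis by (rule antisym[rotated])
qed

lemma vmin_inv: "(s, t) \<in> R \<Longrightarrow> vmin s = vmin t"
proof (rule fixval_invariant[OF ne_min])
  fix U :: "'s \<Rightarrow> real" and x y
  assume U: "\<And>x y. (x, y) \<in> R \<Longrightarrow> U x = U y" and "(x, y) \<in> R"
  then show "min_op (\<lambda>_. UNIV) U x = min_op (\<lambda>_. UNIV) U y"
    using minimax_inv[of U x y] FG_inv[of x y] by (simp add: min_op_def guarded_def)
qed

lemma vmax_inv: "(s, t) \<in> R \<Longrightarrow> vmax s = vmax t"
proof (rule fixval_invariant[OF nonexp_max_op])
  fix U :: "'s \<Rightarrow> real" and x y
  assume U: "\<And>x y. (x, y) \<in> R \<Longrightarrow> U x = U y" and "(x, y) \<in> R"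
  then show "max_op U x = max_op U y"
    using minimax_inv[of "\<lambda>x. - U x" x y] FG_inv[of x y] by (simp add: max_op_def guarded_def)
qed

text \<open>Copies the first move of an optimal nature at \<open>s\<close>. The successors are only
  placed in classes that meet \<open>min_opt\<close>; that such classes lie inside
  \<open>min_opt\<close> is the goal of the next lemma.\<close>

lemma min_opt_choice:
  assumes "s \<in> min_opt" "(s, t) \<in> R" "t \<in> F" "t \<notin> G"
  shows "\<exists>d\<in>choices I t. \<forall>a. av (d a) vmin \<le> vmin t \<and>
    (av (d a) vmin = vmin t \<longrightarrow> set_pmf (d a) \<subseteq> R `` min_opt)"
proof -
  from assms(1) obtain \<pi> where \<pi>: "is_nature I \<pi>" "\<And>\<sigma>. reach F G \<sigma> \<pi> s \<le> vmin s"
    by (auto simp: min_opt_def)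
  have s: "s \<in> F" "s \<notin> G" using assms FG_inv by auto
  obtain d where d: "d \<in> choices I t" "\<forall>a. \<exists>\<rho>. matches (\<pi> [s]) (d a) \<rho>"
    using choice_match[OF assms(2) nature_choices[OF \<pi>(1)]] by blast
  have "av (d a) vmin \<le> vmin t \<and> (av (d a) vmin = vmin t \<longrightarrow> set_pmf (d a) \<subseteq> R `` min_opt)" for a
  proof -
    obtain \<rho> where \<rho>: "matches (\<pi> [s]) (d a) \<rho>" using d(2) by blast
    have eq: "av (d a) vmin = av \<rho> (\<lambda>b. av (\<pi> [s] b) vmin)"
      by (rule matchesD[OF \<rho> vmin_inv])
    have step: "av (\<pi> [s] b) vmin \<le> vmin t" for b
      using min_witness_step(1)[OF \<pi> s] vmin_inv[OF assms(2)] by simp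
    have "set_pmf (d a) \<subseteq> R `` min_opt" if tight: "av (d a) vmin = vmin t"
    proof
      fix x assume "x \<in> set_pmf (d a)"
      then obtain b y where b: "b \<in> set_pmf \<rho>" and y: "y \<in> set_pmf (\<pi> [s] b)" "(x, y) \<in> R"
        using matches_class[OF \<rho>, of x] R_refl by blast
      \<comment> \<open>A weighted average that equals an upper bound of its terms attains the bound
        at every index of positive weight.\<close>
      have "av (\<pi> [s] b) vmin = vmin t"
      proof (rule ccontr)
        assume "av (\<pi> [s] b) vmin \<noteq> vmin t"
        then have "av \<rho> (\<lambda>b. av (\<pi> [s] b) vmin) < av \<rho> (\<lambda>_. vmin t)"
          using step by (intro av_strict_mono[OF _ b]) (auto simp: less_le)
        with tight eq show False by simp
      qed
      then have "reach F G \<sigma> (after s \<pi>) y \<le> vmin y" for \<sigma>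
        using min_witness_step(2)[OF \<pi> s _ y(1)] vmin_inv[OF assms(2)] by simp
      then have "y \<in> min_opt"
        using is_nature_after[OF \<pi>(1)] by (auto simp: min_opt_def)
      with y(2) show "x \<in> R `` min_opt" using R_sym by blast
    qed
    moreover have "av (d a) vmin \<le> vmin t"
      unfolding eq by (rule av_le) (rule step)
    ultimately show ?thesis by blast
  qed
  with d(1) show ?thesis by blast
qed

lemma min_opt_inv:
  assumes "s \<in> min_opt" "(s, t) \<in> R"
  shows "t \<in> min_opt"
proof -
  define Y where "Y = R `` min_opt"
  let ?good = "\<lambda>x d. x \<in> Y \<longrightarrow> x \<in> F \<longrightarrow> x \<notin> G \<longrightarrow> (\<forall>a. av (d a) vmin \<le> vmin x \<and>
    (av (d a) vmin = vmin x \<longrightarrow> set_pmf (d a) \<subseteq> Y))"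
  have "\<forall>x. \<exists>d. d \<in> choices I x \<and> ?good x d"
  proof
    fix x
    show "\<exists>d. d \<in> choices I x \<and> ?good x d"
    proof (cases "x \<in> Y \<and> x \<in> F \<and> x \<notin> G")
      case True
      then show ?thesis using min_opt_choice[of _ x] unfolding Y_def by blast
    next
      case False
      then show ?thesis using choices_nonempty[OF imdp, of x] by blast
    qed
  qed
  from choice[OF this] obtain d where d: "\<And>x. d x \<in> choices I x" "\<And>x. ?good x (d x)" by blast
  let ?X = "(\<lambda>(x, a). vmin x - av (d x a) vmin) `
    {(x, a). x \<in> Y \<and> x \<in> F \<and> x \<notin> G \<and> av (d x a) vmin \<noteq> vmin x}"
  have "\<exists>\<eta>>0. \<eta> \<le> 1 \<and> (\<forall>z\<in>?X. \<eta> \<le> z)"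
    by (rule finite_pos_lower_bound) (use d(2) in \<open>fastforce simp: less_le\<close>)+
  then obtain \<delta> where "0 < \<delta>" and ball: "\<forall>z\<in>?X. \<delta> \<le> z" by (elim exE conjE)
  have gap: "av (d x a) vmin + \<delta> \<le> vmin x"
    if "x \<in> Y" "x \<in> F" "x \<notin> G" "av (d x a) vmin \<noteq> vmin x" for x a
  proof -
    have "\<delta> \<le> vmin x - av (d x a) vmin" by (rule bspec[OF ball]) (use that in force)
    then show ?thesis by simp
  qed
  \<comment> \<open>The tolerance outside \<open>Y\<close> equals the gap: only non-tight actions
    can leave \<open>Y\<close>, and those have lowered the expected value by at least
    \<open>\<delta>\<close>.\<close>
  obtain \<pi>0 where \<pi>0: "is_nature I \<pi>0" "\<And>\<sigma> s. reach F G \<sigma> \<pi>0 s \<le> vmin s + \<delta>"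
    using min_near_optimal[OF \<open>0 < \<delta>\<close>] by blast
  define \<pi> where "\<pi> = switch Y d \<pi>0"
  have "is_nature I \<pi>"
    unfolding \<pi>_def using d(1) \<pi>0(1) by (rule is_nature_switch)
  have bound: "uval F G n \<sigma> \<pi> x \<le> vmin x + (if x \<in> Y then 0 else \<delta>)" for n \<sigma> x
  proof (induction n arbitrary: \<sigma> x)
    case 0
    show ?case using fixval_nonneg[OF ne_min, of x] \<open>0 < \<delta>\<close> by simp
  next
    case (Suc n)
    consider "x \<notin> Y" | "x \<in> Y" "x \<notin> F \<or> x \<in> G" | "x \<in> Y" "x \<in> F" "x \<notin> G" by blast
    then show ?case
    proof cases
      case 1
      have "uval F G (Suc n) \<sigma> \<pi> x = uval F G (Suc n) \<sigma> \<pi>0 x"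
        unfolding uval_def by (rule val_cong) (simp_all add: \<pi>_def switch_outside[OF 1])
      with uval_le_reach[of F G "Suc n" \<sigma> \<pi>0 x] \<pi>0(2)[of \<sigma> x] 1 show ?thesis by simp
    next
      case 2
      then show ?thesis using vmin_unfold[of x] by (auto simp: uval_Suc guarded_def)
    next
      case 3
      let ?u = "uval F G n (after x \<sigma>) (after x \<pi>)"
      have u: "?u y \<le> vmin y + (if y \<in> Y then 0 else \<delta>)" for y
      proof -
        have "?u y = uval F G n (after x \<sigma>) \<pi> y"
          unfolding uval_def by (rule val_cong) (simp_all only: \<pi>_def after_switch[OF 3(1)])
        then show ?thesis using Suc.IH[of "after x \<sigma>" y] by simp
      qed
      have "av (d x a) ?u \<le> vmin x" for a
      proof (cases "av (d x a) vmin = vmin x")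
        case True
        then have sub: "set_pmf (d x a) \<subseteq> Y" using d(2) 3 by blast
        have "?u y \<le> vmin y" if "y \<in> set_pmf (d x a)" for y
          using u[of y] subsetD[OF sub that] by simp
        then have "av (d x a) ?u \<le> av (d x a) vmin" by (rule av_mono)
        with True show ?thesis by simp
      next
        case False
        have "?u y \<le> vmin y + \<delta>" for y
          using u[of y] \<open>0 < \<delta>\<close> by (auto split: if_splits)
        then have "av (d x a) ?u \<le> av (d x a) (\<lambda>y. vmin y + \<delta>)" by (intro av_mono)
        also have "\<dots> \<le> vmin x" using gap[OF 3 False] by (simp add: av_add)
        finally show ?thesis .
      qed
      moreover have "\<pi> [x] = d x" using 3 by (simp add: \<pi>_def)
      ultimately have "av (\<sigma> [x]) (\<lambda>a. av (\<pi> [x] a) ?u) \<le> vmin x" by (simp add: av_le)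
      then show ?thesis using 3 by (simp add: uval_Suc)
    qed
  qed
  have "t \<in> Y" using assms by (auto simp: Y_def)
  with bound[of _ _ t] have "reach F G \<sigma> \<pi> t \<le> vmin t" for \<sigma>
    by (intro reach_le) simp
  with \<open>is_nature I \<pi>\<close> show ?thesis by (auto simp: min_opt_def)
qed

end

section \<open>Optimal maximising natures\<close>

context until_bisim begin

text \<open>Unlike a minimising nature, a maximising one must also make progress: the stage of a state
  bounds the number of tight steps after which the target can have been reached with positive
  probability.\<close>

primrec stage :: "nat \<Rightarrow> 's set" where
  "stage 0 = {s \<in> R `` max_opt. vmax s \<le> 0 \<or> s \<notin> F \<or> s \<in> G}"
| "stage (Suc n) = stage n \<union> {s \<in> R `` max_opt. \<exists>c\<in>choices I s. \<forall>a. vmax s \<le> av (c a) vmax \<and>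
     (av (c a) vmax = vmax s \<longrightarrow> set_pmf (c a) \<subseteq> R `` max_opt \<and> set_pmf (c a) \<inter> stage n \<noteq> {})}"

lemma stage_mono: "m \<le> n \<Longrightarrow> stage m \<subseteq> stage n"
  by (rule lift_Suc_mono_le[of stage]) auto

lemma max_opt_class_closed: "(x, y) \<in> R \<Longrightarrow> x \<in> R `` max_opt \<Longrightarrow> y \<in> R `` max_opt"
  using R_trans by blast

text \<open>Tightness at \<open>t\<close> forces tightness of every action of \<open>s\<close> in
  the matching mixture. The support conditions hold for those actions and return to \<open>t\<close>
  class by class.\<close>

lemma stage_closed: "s \<in> stage n \<Longrightarrow> (s, t) \<in> R \<Longrightarrow> t \<in> stage n"
proof (induction n arbitrary: s t)
  case 0
  then show ?case
    using max_opt_class_closed[of s t] FG_inv[of s t] vmax_inv[of s t] by auto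
next
  case (Suc n)
  show ?case
  proof (cases "s \<in> stage n")
    case True
    with Suc.IH Suc.prems(2) have "t \<in> stage n" by blast
    then show ?thesis by simp
  next
    case False
    with Suc.prems(1) obtain c where s: "s \<in> R `` max_opt" and c: "c \<in> choices I s"
      and ge: "\<And>a. vmax s \<le> av (c a) vmax"
      and tight: "\<And>a. av (c a) vmax = vmax s \<Longrightarrow> set_pmf (c a) \<subseteq> R `` max_opt \<and> set_pmf (c a) \<inter> stage n \<noteq> {}"
      by auto
    obtain d where d: "d \<in> choices I t" "\<forall>a. \<exists>\<rho>. matches c (d a) \<rho>"
      using choice_match[OF Suc.prems(2) c] by blast
    have "vmax t \<le> av (d a) vmax \<and> (av (d a) vmax = vmax t \<longrightarrow>
        set_pmf (d a) \<subseteq> R `` max_opt \<and> set_pmf (d a) \<inter> stage n \<noteq> {})" for a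
    proof -
      obtain \<rho> where \<rho>: "matches c (d a) \<rho>" using d(2) by blast
      have eq: "av (d a) vmax = av \<rho> (\<lambda>b. av (c b) vmax)"
        by (rule matchesD[OF \<rho> vmax_inv])
      have vst: "vmax s = vmax t" by (rule vmax_inv[OF Suc.prems(2)])
      have "set_pmf (d a) \<subseteq> R `` max_opt \<and> set_pmf (d a) \<inter> stage n \<noteq> {}"
        if "av (d a) vmax = vmax t"
      proof -
        have tb: "av (c b) vmax = vmax s" if b: "b \<in> set_pmf \<rho>" for b
        proof (rule ccontr)
          assume "av (c b) vmax \<noteq> vmax s"
          then have "av \<rho> (\<lambda>_. vmax s) < av \<rho> (\<lambda>b. av (c b) vmax)"
            using ge by (intro av_strict_mono[OF _ b]) (auto simp: less_le)
          with \<open>av (d a) vmax = vmax t\<close> eq vst show False by simp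
        qed
        have "set_pmf (d a) \<subseteq> R `` max_opt"
        proof
          fix x assume "x \<in> set_pmf (d a)"
          then obtain b y where b: "b \<in> set_pmf \<rho>" and y: "y \<in> set_pmf (c b)" "(x, y) \<in> R"
            using matches_class[OF \<rho>, of x] R_refl by blast
          then have "y \<in> R `` max_opt" using tight[OF tb[OF b]] by blast
          then show "x \<in> R `` max_opt" by (rule max_opt_class_closed[OF R_sym[OF y(2)]])
        qed
        moreover obtain b where b: "b \<in> set_pmf \<rho>" using set_pmf_not_empty[of \<rho>] by blast
        then obtain y where y: "y \<in> set_pmf (c b)" "y \<in> stage n" using tight[OF tb[OF b]] by blast
        then obtain x where x: "x \<in> set_pmf (d a)" "(y, x) \<in> R"
          using matches_class[OF \<rho>, of y] b R_refl by blast
        then have "x \<in> stage n" using Suc.IH y(2) by blast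
        ultimately show ?thesis using x(1) by blast
      qed
      moreover have "vmax t \<le> av (d a) vmax"
        unfolding eq vst[symmetric] by (rule av_ge) (rule ge)
      ultimately show ?thesis by blast
    qed
    moreover have "t \<in> R `` max_opt" using max_opt_class_closed[OF Suc.prems(2) s] .
    ultimately show ?thesis using d(1) by (simp only: stage.simps) blast
  qed
qed

text \<open>Outside all stages some tight action avoids them all. Repeating such actions keeps the
  remaining nature optimal but never meets the target, so the probability is 0, although the value
  is positive outside \<open>stage 0\<close>.\<close>

lemma max_opt_stage:
  assumes "s \<in> max_opt"
  shows "\<exists>n. s \<in> stage n"
proof (rule ccontr)
  assume contra: "\<not> ?thesis"
  define A where "A = (\<Union>n. stage n)"
  define avoid where "avoid \<pi> w a \<longleftrightarrow> av (\<pi> w a) vmax = vmax (last w) \<and> set_pmf (\<pi> w a) \<inter> A = {}"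
    for \<pi> :: "'s list \<Rightarrow> 'a \<Rightarrow> 's pmf" and w a
  define g where "g \<pi> w = return_pmf (SOME a. avoid \<pi> w a)" for \<pi> w
  have opt: "x \<in> R `` max_opt" if "is_nature I \<pi>" "\<forall>\<sigma>. vmax x \<le> reach F G \<sigma> \<pi> x" for \<pi> x
    using that R_refl[of x] by (auto simp: max_opt_def)
  have base: "0 < vmax x \<and> x \<in> F \<and> x \<notin> G" if "x \<in> R `` max_opt" "x \<notin> A" for x
  proof -
    have "x \<notin> stage 0" using that(2) unfolding A_def by blast
    with that(1) show ?thesis by auto
  qed
  have zero: "is_nature I \<pi> \<Longrightarrow> \<forall>\<sigma>. vmax x \<le> reach F G \<sigma> \<pi> x \<Longrightarrow> x \<notin> A \<Longrightarrow> uval F G n (g \<pi>) \<pi> x = 0" for n \<pi> x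
  proof (induction n arbitrary: \<pi> x)
    case (Suc n)
    note x = base[OF opt[OF Suc.prems(1,2)] Suc.prems(3)]
    have xF: "x \<in> F" "x \<notin> G" using x by auto
    note step = max_witness_step[OF Suc.prems(1) Suc.prems(2)[rule_format] xF]
    have "\<exists>a. avoid \<pi> [x] a"
    proof (rule ccontr)
      assume none: "\<not> ?thesis"
      have "\<exists>n. set_pmf (\<pi> [x] a) \<inter> stage n \<noteq> {}" if "av (\<pi> [x] a) vmax = vmax x" for a
        using none that unfolding avoid_def A_def by fastforce
      then have "\<forall>a. \<exists>n. av (\<pi> [x] a) vmax = vmax x \<longrightarrow> set_pmf (\<pi> [x] a) \<inter> stage n \<noteq> {}" by blast
      from choice[OF this] obtain m where
        m: "\<And>a. av (\<pi> [x] a) vmax = vmax x \<Longrightarrow> set_pmf (\<pi> [x] a) \<inter> stage (m a) \<noteq> {}" by blast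
      \<comment> \<open>Each tight action meets some stage. Finitely many actions and monotone
        stages give one level for all of them, which would put \<open>x\<close> in the next
        stage.\<close>
      let ?m = "Max (range m)"
      have "set_pmf (\<pi> [x] a) \<inter> stage ?m \<noteq> {}" if "av (\<pi> [x] a) vmax = vmax x" for a
        using m[OF that] stage_mono[of "m a" ?m] by auto
      moreover have "set_pmf (\<pi> [x] a) \<subseteq> R `` max_opt" if "av (\<pi> [x] a) vmax = vmax x" for a
        using opt[OF is_nature_after[OF Suc.prems(1)]] step(2)[OF that] by blast
      ultimately have "x \<in> stage (Suc ?m)"
        using opt[OF Suc.prems(1,2)] nature_choices[OF Suc.prems(1), of x] step(1)
        by (simp only: stage.simps) blast
      with Suc.prems(3) show False unfolding A_def by blast
    qed
    then have "avoid \<pi> [x] (SOME a. avoid \<pi> [x] a)" by (rule someI_ex)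
    then obtain a where a: "avoid \<pi> [x] a" "g \<pi> [x] = return_pmf a" by (auto simp: g_def)
    have "uval F G n (after x (g \<pi>)) (after x \<pi>) y = 0" if y: "y \<in> set_pmf (\<pi> [x] a)" for y
    proof -
      have "uval F G n (after x (g \<pi>)) (after x \<pi>) y = uval F G n (g (after x \<pi>)) (after x \<pi>) y"
        unfolding uval_def by (rule val_cong) (simp_all add: after_def g_def avoid_def)
      also have "\<dots> = 0"
        using a(1) y step(2)[of a y] by (intro Suc.IH is_nature_after Suc.prems) (auto simp: avoid_def)
      finally show ?thesis .
    qed
    then have "av (\<pi> [x] a) (uval F G n (after x (g \<pi>)) (after x \<pi>)) = av (\<pi> [x] a) (\<lambda>_. 0)"
      by (rule av_cong)
    then show ?case using a(2) xF by (simp add: uval_Suc)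
  qed simp
  from assms obtain \<pi> where \<pi>: "is_nature I \<pi>" "\<forall>\<sigma>. vmax s \<le> reach F G \<sigma> \<pi> s"
    by (auto simp: max_opt_def)
  have "s \<notin> A" using contra by (auto simp: A_def)
  have "reach F G (g \<pi>) \<pi> s \<le> 0"
    by (rule reach_le) (simp add: zero[OF \<pi> \<open>s \<notin> A\<close>])
  with \<pi>(2)[rule_format, of "g \<pi>"] base[OF opt[OF \<pi>] \<open>s \<notin> A\<close>] show False by simp
qed

definition rank :: "'s \<Rightarrow> nat" where
  "rank x = (LEAST n. x \<in> stage n)"

text \<open>The side conditions exclude \<open>stage 0\<close>, so \<open>x\<close> entered at a
  successor stage. The witness of that entry meets the previous stage and hence a state of smaller
  rank.\<close>

lemma max_opt_ranked_choice:
  assumes "x \<in> R `` max_opt" "0 < vmax x" "x \<in> F" "x \<notin> G"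
  shows "\<exists>c\<in>choices I x. \<forall>a. vmax x \<le> av (c a) vmax \<and>
     (av (c a) vmax = vmax x \<longrightarrow> set_pmf (c a) \<subseteq> R `` max_opt \<and> (\<exists>y\<in>set_pmf (c a). rank y < rank x))"
proof -
  from assms(1) obtain s n where "(s, x) \<in> R" "s \<in> stage n"
    using max_opt_stage by blast
  then have "x \<in> stage n" using stage_closed by blast
  then have x: "x \<in> stage (rank x)" and least: "\<And>m. m < rank x \<Longrightarrow> x \<notin> stage m"
    unfolding rank_def by (auto intro: LeastI dest: not_less_Least)
  have "rank x \<noteq> 0" using x assms(2-4) by (intro notI) simp
  then obtain m where m: "rank x = Suc m" by (cases "rank x") auto
  have y: "rank y < rank x" if "y \<in> stage m" for y
    using that Least_le[of "\<lambda>n. y \<in> stage n" m] by (simp add: rank_def[of y] m)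
  have "x \<in> stage (Suc m)" "x \<notin> stage m" using x least m by auto
  then obtain c where "c \<in> choices I x" "\<forall>a. vmax x \<le> av (c a) vmax \<and>
     (av (c a) vmax = vmax x \<longrightarrow> set_pmf (c a) \<subseteq> R `` max_opt \<and> set_pmf (c a) \<inter> stage m \<noteq> {})"
    by auto
  with y show ?thesis by blast
qed

text \<open>Among the states of \<open>Y\<close> where the memoryless nature falls short of
  \<open>vmax\<close> by most, take one of least rank. A tight action there reaches a state of lower
  rank with smaller shortfall, and a non-tight one has a compensating gain, so every action does
  strictly better than the assumed value.\<close>

lemma max_opt_inv:
  assumes "s \<in> max_opt" "(s, t) \<in> R"
  shows "t \<in> max_opt"
proof -
  define Y where "Y = R `` max_opt"
  let ?good = "\<lambda>x d. x \<in> Y \<longrightarrow> 0 < vmax x \<longrightarrow> x \<in> F \<longrightarrow> x \<notin> G \<longrightarrow> (\<forall>a. vmax x \<le> av (d a) vmax \<and>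
    (av (d a) vmax = vmax x \<longrightarrow> set_pmf (d a) \<subseteq> Y \<and> (\<exists>y\<in>set_pmf (d a). rank y < rank x)))"
  have "\<forall>x. \<exists>d. d \<in> choices I x \<and> ?good x d"
  proof
    fix x
    show "\<exists>d. d \<in> choices I x \<and> ?good x d"
    proof (cases "x \<in> Y \<and> 0 < vmax x \<and> x \<in> F \<and> x \<notin> G")
      case True
      then show ?thesis using max_opt_ranked_choice[of x] unfolding Y_def by blast
    next
      case False
      then show ?thesis using choices_nonempty[OF imdp, of x] by blast
    qed
  qed
  from choice[OF this] obtain d where d: "\<And>x. d x \<in> choices I x" "\<And>x. ?good x (d x)" by blast
  let ?X = "(\<lambda>(x, a). av (d x a) vmax - vmax x) `
    {(x, a). x \<in> Y \<and> 0 < vmax x \<and> x \<in> F \<and> x \<notin> G \<and> av (d x a) vmax \<noteq> vmax x}"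
  have "\<exists>\<eta>>0. \<eta> \<le> 1 \<and> (\<forall>z\<in>?X. \<eta> \<le> z)"
    by (rule finite_pos_lower_bound) (use d(2) in \<open>fastforce simp: less_le\<close>)+
  then obtain \<eta> where "0 < \<eta>" and ball: "\<forall>z\<in>?X. \<eta> \<le> z" by (elim exE conjE)
  define \<delta> where "\<delta> = \<eta> / 2"
  have "0 < \<delta>" using \<open>0 < \<eta>\<close> by (simp add: \<delta>_def)
  have gap: "vmax x + 2 * \<delta> \<le> av (d x a) vmax"
    if "x \<in> Y" "0 < vmax x" "x \<in> F" "x \<notin> G" "av (d x a) vmax \<noteq> vmax x" for x a
  proof -
    have "\<eta> \<le> av (d x a) vmax - vmax x" by (rule bspec[OF ball]) (use that in force)
    then show ?thesis by (simp add: \<delta>_def)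
  qed
  obtain \<pi>0 where \<pi>0: "is_nature I \<pi>0" "\<And>\<sigma> s. vmax s - \<delta> \<le> reach F G \<sigma> \<pi>0 s"
    using max_near_optimal[OF \<open>0 < \<delta>\<close>] by blast
  define \<pi> where "\<pi> = switch Y d \<pi>0"
  have "is_nature I \<pi>"
    unfolding \<pi>_def using d(1) \<pi>0(1) by (rule is_nature_switch)
  define y where "y x = (INF \<sigma>. reach F G \<sigma> \<pi> x)" for x
  have bdd: "bdd_below (range (\<lambda>\<sigma>. reach F G \<sigma> \<pi> x))" for x
    by (rule bdd_belowI2[of _ 0]) (rule reach_nonneg)
  have y_le: "y x \<le> reach F G \<sigma> \<pi> x" for x \<sigma>
    unfolding y_def by (rule cINF_lower[OF bdd]) simp
  have y_ge: "b \<le> y x" if "\<And>\<sigma>. b \<le> reach F G \<sigma> \<pi> x" for b x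
    unfolding y_def by (rule cINF_greatest) (use that in auto)
  \<comment> \<open>What is guaranteed from each successor: the value of the play within
    \<open>Y\<close>, and the near-optimal bound after leaving it.\<close>
  define z where "z x = (if x \<in> Y then y x else vmax x - \<delta>)" for x
  have z_le: "z x \<le> reach F G \<sigma> \<pi> x" for x \<sigma>
  proof (cases "x \<in> Y")
    case False
    have "reach F G \<sigma> \<pi> x = reach F G \<sigma> \<pi>0 x"
      by (rule reach_cong) (simp_all add: \<pi>_def switch_outside[OF False])
    then show ?thesis using \<pi>0(2)[of x \<sigma>] False by (simp add: z_def)
  qed (simp add: z_def y_le)
  have "vmax x \<le> y x" if "x \<in> Y" for x
  proof (rule ccontr)
    assume contra: "\<not> vmax x \<le> y x"
    define e where "e = Max ((\<lambda>x. vmax x - y x) ` Y)"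
    have le_e: "vmax x - y x \<le> e" if "x \<in> Y" for x
      unfolding e_def by (rule Max_ge) (use that in auto)
    have "0 < e" using le_e[OF that] contra by simp
    define D where "D = {x \<in> Y. vmax x - y x = e}"
    have "e \<in> (\<lambda>x. vmax x - y x) ` Y"
      unfolding e_def by (rule Max_in) (use that in auto)
    then obtain x0 where "x0 \<in> D" by (auto simp: D_def)
    then obtain u where u: "u \<in> D" and u_min: "\<And>v. v \<in> D \<Longrightarrow> rank u \<le> rank v"
      using ex_has_least_nat[of "\<lambda>x. x \<in> D" x0 rank] by blast
    have uY: "u \<in> Y" and y_u: "y u = vmax u - e" using u by (auto simp: D_def)
    have y_nonneg: "0 \<le> y x" for x
      by (rule y_ge) (rule reach_nonneg)
    have "0 < vmax u" using y_nonneg[of u] y_u \<open>0 < e\<close> by simp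
    have uF: "u \<in> F" "u \<notin> G"
    proof -
      have "u \<notin> G"
      proof
        assume "u \<in> G"
        then have "1 \<le> y u" by (intro y_ge) (subst reach_unfold, simp)
        then show False using fixval_le_1[OF nonexp_max_op, of u] y_u \<open>0 < e\<close> by simp
      qed
      moreover have "u \<in> F"
        using \<open>0 < vmax u\<close> vmax_unfold[of u] \<open>u \<notin> G\<close> by (auto simp: guarded_def split: if_splits)
      ultimately show "u \<in> F" "u \<notin> G" by auto
    qed
    have strict: "vmax u - e < av (d u a) z" for a
    proof (cases "av (d u a) vmax = vmax u")
      case True
      then have sub: "set_pmf (d u a) \<subseteq> Y" and "\<exists>v\<in>set_pmf (d u a). rank v < rank u"
        using d(2)[of u] uY \<open>0 < vmax u\<close> uF by blast+
      then obtain v where v: "v \<in> set_pmf (d u a)" "rank v < rank u" by blast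
      then have "v \<notin> D" using u_min by force
      have "av (d u a) (\<lambda>x. vmax x - e) < av (d u a) z"
      proof (rule av_strict_mono[OF _ v(1)])
        show "vmax x - e \<le> z x" if "x \<in> set_pmf (d u a)" for x
          using that sub le_e[of x] by (auto simp: z_def)
        show "vmax v - e < z v"
          using v(1) sub \<open>v \<notin> D\<close> le_e[of v] by (auto simp: z_def D_def less_le)
      qed
      with True show ?thesis by (simp add: av_diff)
    next
      case False
      \<comment> \<open>The loss is at most \<open>e\<close> inside \<open>Y\<close> and at most
        \<open>\<delta>\<close> outside. The gap \<open>2 * \<delta>\<close> makes the net result
        exceed \<open>vmax u - e\<close> in either case.\<close>
      have "vmax x - max e \<delta> \<le> z x" for x
        using le_e[of x] by (auto simp: z_def max_def)
      then have "av (d u a) (\<lambda>x. vmax x - max e \<delta>) \<le> av (d u a) z" by (intro av_mono)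
      then have "av (d u a) vmax - max e \<delta> \<le> av (d u a) z" by (simp add: av_diff)
      with gap[OF uY \<open>0 < vmax u\<close> uF False] \<open>0 < e\<close> \<open>0 < \<delta>\<close> show ?thesis
        by (simp add: max_def split: if_splits)
    qed
    \<comment> \<open>The infimum over schedulers need not be attained. The minimum over finitely
      many actions turns strictness for each action into a bound uniform in
      \<open>\<sigma>\<close>.\<close>
    define m where "m = Min (range (\<lambda>a. av (d u a) z))"
    have "vmax u - e < m"
      unfolding m_def using strict by (subst Min_gr_iff) auto
    moreover have "m \<le> y u"
    proof (rule y_ge)
      fix \<sigma>
      have "\<pi> [u] = d u" using uY by (simp add: \<pi>_def)
      then have eq: "reach F G \<sigma> \<pi> u = av (\<sigma> [u]) (\<lambda>a. av (d u a) (reach F G (after u \<sigma>) (after u \<pi>)))"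
        using uF by (subst reach_unfold) simp
      have "z x \<le> reach F G (after u \<sigma>) (after u \<pi>) x" for x
      proof -
        have "reach F G (after u \<sigma>) (after u \<pi>) x = reach F G (after u \<sigma>) \<pi> x"
          by (rule reach_cong) (simp_all only: \<pi>_def after_switch[OF uY])
        then show ?thesis using z_le by simp
      qed
      then have "av (d u a) z \<le> av (d u a) (reach F G (after u \<sigma>) (after u \<pi>))" for a
        by (rule av_mono)
      moreover have "m \<le> av (d u a) z" for a
        unfolding m_def by (rule Min_le) auto
      ultimately have "m \<le> av (d u a) (reach F G (after u \<sigma>) (after u \<pi>))" for a
        by (rule order_trans[rotated])
      then show "m \<le> reach F G \<sigma> \<pi> u"
        unfolding eq by (rule av_ge)
    qed
    ultimately show False using y_u by simp
  qed
  moreover have "t \<in> Y" using assms by (auto simp: Y_def)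
  ultimately have "vmax t \<le> reach F G \<sigma> \<pi> t" for \<sigma>
    using y_le[of t \<sigma>] by (meson order_trans)
  with \<open>is_nature I \<pi>\<close> show ?thesis by (auto simp: max_opt_def)
qed

lemma reach_cmp_transfer:
  assumes st: "(s, t) \<in> R"
    and ex: "\<exists>\<pi>. is_nature I \<pi> \<and> (\<forall>\<sigma>::'s list \<Rightarrow> 'a pmf. cmp_holds c (reach F G \<sigma> \<pi> s) p)"
  shows "\<exists>\<pi>. is_nature I \<pi> \<and> (\<forall>\<sigma>::'s list \<Rightarrow> 'a pmf. cmp_holds c (reach F G \<sigma> \<pi> t) p)"
proof (cases c)
  case CLe
  then show ?thesis
    using ex vmin_inv[OF st] min_opt_inv[OF _ st] by (simp add: vmin_le_iff) blast
next
  case CLt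
  then show ?thesis using ex vmin_inv[OF st] by (simp add: vmin_less_iff)
next
  case CGe
  then show ?thesis
    using ex vmax_inv[OF st] max_opt_inv[OF _ st] by (simp add: vmax_ge_iff) blast
next
  case CGt
  then show ?thesis using ex vmax_inv[OF st] by (simp add: vmax_greater_iff)
qed

end

section \<open>Invariance of satisfaction\<close>

lemma until_cmp_transfer:
  fixes I :: "'s::finite \<Rightarrow> 'a::finite \<Rightarrow> 's \<Rightarrow> real set"
  assumes "is_IMDP I" "is_bisim L I R"
    and "\<And>x y. (x, y) \<in> R \<Longrightarrow> (x \<in> F \<longleftrightarrow> y \<in> F) \<and> (x \<in> G \<longleftrightarrow> y \<in> G)"
    and "(s, t) \<in> R"
    and "\<exists>\<pi>. is_nature I \<pi> \<and> (\<forall>\<sigma>::'s list \<Rightarrow> 'a pmf. cmp_holds c (reach F G \<sigma> \<pi> s) p)"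
  shows "\<exists>\<pi>. is_nature I \<pi> \<and> (\<forall>\<sigma>::'s list \<Rightarrow> 'a pmf. cmp_holds c (reach F G \<sigma> \<pi> t) p)"
proof -
  interpret until_bisim I F G L R
    by unfold_locales (rule assms(1), rule assms(2), rule assms(3))
  show ?thesis using assms(4,5) by (rule reach_cmp_transfer)
qed

text \<open>Path formulas are not evaluated at states, so the induction statement for
  \<open>\<psi>\<close> speaks of \<open>SProb c p \<psi>\<close> for all \<open>c\<close> and
  \<open>p\<close>.\<close>

lemma sat_bisim_invariant:
  fixes I :: "'s::finite \<Rightarrow> 'a::finite \<Rightarrow> 's \<Rightarrow> real set"
  assumes imdp: "is_IMDP I" and bisim: "is_bisim L I R"
  shows "(s, t) \<in> R \<Longrightarrow> sat_state L I s \<phi> \<longleftrightarrow> sat_state L I t \<phi>"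
    and "(s, t) \<in> R \<Longrightarrow> sat_state L I s (SProb c p \<psi>) \<longleftrightarrow> sat_state L I t (SProb c p \<psi>)"
proof (induction \<phi> and \<psi> arbitrary: s t and s t c p)
  case (SAtom x)
  then show ?case using bisim by (auto simp: is_bisim_def)
next
  case (PNext f)
  let ?T = "{x. sat_state L I x f}"
  have inv: "(x \<in> {} \<longleftrightarrow> y \<in> {}) \<and> indicator {} x = (indicator {} y :: real) \<and>
      indicator ?T x = (indicator ?T y :: real)" if "(x, y) \<in> R" for x y
    using PNext.IH[OF that] by (simp add: indicator_def)
  have sat: "sat_state L I s (SProb c p (PNext f)) \<longleftrightarrow> (\<exists>\<pi>. is_nature I \<pi> \<and> (\<forall>\<sigma>::'s list \<Rightarrow> 'a pmf.
      cmp_holds c (val {} (indicator {}) (indicator ?T) 1 \<sigma> \<pi> s) (real_of_rat p)))" for s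
    unfolding Pr_next[symmetric] by simp
  have "(t, s) \<in> R" using PNext.prems bisim by (auto simp: is_bisim_def equiv_def sym_def)
  then show ?case
    unfolding sat using val_cmp_transfer[OF imdp bisim inv] PNext.prems by blast
next
  case (PUntil f g)
  let ?F = "{x. sat_state L I x f}" and ?G = "{x. sat_state L I x g}"
  have inv: "(x \<in> ?F \<longleftrightarrow> y \<in> ?F) \<and> (x \<in> ?G \<longleftrightarrow> y \<in> ?G)" if "(x, y) \<in> R" for x y
    using PUntil.IH that by blast
  have sat: "sat_state L I s (SProb c p (PUntil f g)) \<longleftrightarrow> (\<exists>\<pi>. is_nature I \<pi> \<and> (\<forall>\<sigma>::'s list \<Rightarrow> 'a pmf.
      cmp_holds c (reach ?F ?G \<sigma> \<pi> s) (real_of_rat p)))" for s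
    unfolding Pr_until[symmetric] by simp
  have "(t, s) \<in> R" using PUntil.prems bisim by (auto simp: is_bisim_def equiv_def sym_def)
  then show ?case
    unfolding sat using until_cmp_transfer[OF imdp bisim inv] PUntil.prems by blast
next
  case (PBUntil f g k)
  let ?F = "{x. sat_state L I x f}" and ?G = "{x. sat_state L I x g}"
  have inv: "(x \<in> ?G \<union> - ?F \<longleftrightarrow> y \<in> ?G \<union> - ?F) \<and> indicator ?G x = (indicator ?G y :: real) \<and>
      (0 :: real) = 0" if "(x, y) \<in> R" for x y
    using PBUntil.IH[OF that] by (simp add: indicator_def)
  have sat: "sat_state L I s (SProb c p (PBUntil f g k)) \<longleftrightarrow> (\<exists>\<pi>. is_nature I \<pi> \<and> (\<forall>\<sigma>::'s list \<Rightarrow> 'a pmf.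
      cmp_holds c (val (?G \<union> - ?F) (indicator ?G) (\<lambda>_. 0) k \<sigma> \<pi> s) (real_of_rat p)))" for s
    unfolding uval_def[symmetric] Pr_bounded_until[symmetric] by simp
  have "(t, s) \<in> R" using PBUntil.prems bisim by (auto simp: is_bisim_def equiv_def sym_def)
  then show ?case
    unfolding sat using val_cmp_transfer[OF imdp bisim inv] PBUntil.prems by blast
qed auto

theorem theorem3:
  fixes L :: "'s::finite \<Rightarrow> 'ap::finite set"
    and I :: "'s \<Rightarrow> 'a::finite \<Rightarrow> 's \<Rightarrow> real set"
    and s t :: 's
    and \<phi> :: "'ap sform"
  assumes "is_IMDP I"
    and "bisimilar L I s t"
    and "wf_sform \<phi>"
  shows "sat_state L I s \<phi> \<longleftrightarrow> sat_state L I t \<phi>"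
proof -
  from assms(2) obtain R where "is_bisim L I R" "(s, t) \<in> R"
    by (auto simp: bisimilar_def)
  then show ?thesis
    using sat_bisim_invariant(1)[OF assms(1)] by blast
qed

end
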